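(* Let $G$ be a group acting by automorphisms of a group $V$, and let $\Gamma$ be a subgroup of $G$ leaving a subgroup $V_0$ of $V$ invariant. Then $(V\rtimes G,V_0\rtimes\Gamma)$ is a Hecke pair if and only if the following conditions are satisfied: (i) $(V,V_0)$ is a Hecke pair such that the action of $\Gamma$ on $V_0\backslash V/V_0$ has finite orbits; and (ii) $(G,\Gamma)$ is a Hecke pair such that $V_0$ and $g(V_0)$ are commensurable subgroups of $V$ for every $g\in G$. If (i) and (ii) hold, then we have an embedding $\mathcal H(V,V_0)^\Gamma\hookrightarrow\mathcal H(V\rtimes G,V_0\rtimes\Gamma)$ of Hecke algebras, and for $v\in V$, $g\in G$, $$R_{V_0\rtimes\Gamma}(vg)=R_\Gamma(g)\,|V_0\backslash V_0\,O_{\Gamma_g}(v)\,g(V_0)|,$$ $$L_{V_0\rtimes\Gamma}(vg)=L_\Gamma(g)\,|V_0\,O_{\Gamma_g}(v)\,g(V_0)/g(V_0)|,$$ where $\Gamma_g=g\Gamma g^{-1}\cap\Gamma$ and $O_{\Gamma_g}(v)$ denotes the $\Gamma_g$-orbit of $v\in V$. Furthermore, $$\Delta_{V_0\rtimes\Gamma}(vg)=\Delta_{V_0}(v)\,\Delta_\Gamma(g)\,\frac{|V_0/(V_0\cap g(V_0))|}{|V_0/(V_0\cap g^{-1}(V_0))|}.$$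
   Context: A pair $(N,N_0)$ of a group and a subgroup is a Hecke pair if $L_{N_0}(x):=[N_0:N_0\cap xN_0x^{-1}]$ is finite for all $x\in N$; $L_{N_0}(x)$ is the number of left $N_0$-cosets in $N_0xN_0$, and $R_{N_0}(x):=L_{N_0}(x^{-1})$ is the number of right $N_0$-cosets in $N_0xN_0$. The modular function is $\Delta_{N_0}(x)=L_{N_0}(x)/L_{N_0}(x^{-1})$. The Hecke algebra $\mathcal H(N,N_0)$ is the space of complex $N_0$-biinvariant functions on $N$ supported on finitely many double cosets, with product $(f_1*f_2)(x)=\sum_{y\in N_0\backslash N}f_1(xy^{-1})f_2(y)$ and involution $f^*(x)=\overline{f(x^{-1})}$. Semidirect products: $(v,g)(w,h)=(v\,g(w),gh)$, and $vg$ denotes $(v,g)$. $\mathcal H(V,V_0)^\Gamma$ is the fixed point algebra for the action of $\Gamma$ on $\mathcal H(V,V_0)$ induced by the action on $V$. Two subgroups $K_1,K_2$ of a group are commensurable if $K_1\cap K_2$ has finite index in both. *)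

theory Defs
  imports Complex_Main "HOL-Algebra.Module" "HOL-Algebra.Group_Action"
begin

definition left_cosets_of :: "('a, 'm) monoid_scheme \<Rightarrow> 'a set \<Rightarrow> 'a set \<Rightarrow> 'a set set" where
  "left_cosets_of N S K = (\<lambda>x. x <#\<^bsub>N\<^esub> K) ` S" \<comment> \<open>\<open>S / K\<close>, for \<open>S\<close> with \<open>S K = S\<close>\<close>

definition right_cosets_of :: "('a, 'm) monoid_scheme \<Rightarrow> 'a set \<Rightarrow> 'a set \<Rightarrow> 'a set set" where
  "right_cosets_of N K S = (\<lambda>x. K #>\<^bsub>N\<^esub> x) ` S" \<comment> \<open>\<open>K \ S\<close>, for \<open>S\<close> with \<open>K S = S\<close>\<close>

definition conj_subgroup :: "('a, 'm) monoid_scheme \<Rightarrow> 'a \<Rightarrow> 'a set \<Rightarrow> 'a set" where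
  "conj_subgroup N x H = (x <#\<^bsub>N\<^esub> H) #>\<^bsub>N\<^esub> inv\<^bsub>N\<^esub> x"

definition double_coset :: "('a, 'm) monoid_scheme \<Rightarrow> 'a set \<Rightarrow> 'a \<Rightarrow> 'a set" where
  "double_coset N N0 x = (N0 #>\<^bsub>N\<^esub> x) <#>\<^bsub>N\<^esub> N0"

definition double_cosets :: "('a, 'm) monoid_scheme \<Rightarrow> 'a set \<Rightarrow> 'a set set" where
  "double_cosets N N0 = double_coset N N0 ` carrier N"

definition finite_index :: "('a, 'm) monoid_scheme \<Rightarrow> 'a set \<Rightarrow> 'a set \<Rightarrow> bool" where
  "finite_index N H K \<longleftrightarrow> finite (left_cosets_of N H K)"

definition sub_index :: "('a, 'm) monoid_scheme \<Rightarrow> 'a set \<Rightarrow> 'a set \<Rightarrow> nat" where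
  "sub_index N H K = card (left_cosets_of N H K)"

definition commensurable :: "('a, 'm) monoid_scheme \<Rightarrow> 'a set \<Rightarrow> 'a set \<Rightarrow> bool" where
  "commensurable N K1 K2 \<longleftrightarrow> finite_index N K1 (K1 \<inter> K2) \<and> finite_index N K2 (K1 \<inter> K2)"

definition hecke_pair :: "('a, 'm) monoid_scheme \<Rightarrow> 'a set \<Rightarrow> bool" where
  "hecke_pair N N0 \<longleftrightarrow> group N \<and> subgroup N0 N \<and>
     (\<forall>x\<in>carrier N. finite_index N N0 (N0 \<inter> conj_subgroup N x N0))"

definition hecke_L :: "('a, 'm) monoid_scheme \<Rightarrow> 'a set \<Rightarrow> 'a \<Rightarrow> nat" where
  "hecke_L N N0 x = sub_index N N0 (N0 \<inter> conj_subgroup N x N0)"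

definition hecke_R :: "('a, 'm) monoid_scheme \<Rightarrow> 'a set \<Rightarrow> 'a \<Rightarrow> nat" where
  "hecke_R N N0 x = hecke_L N N0 (inv\<^bsub>N\<^esub> x)"

definition hecke_modular :: "('a, 'm) monoid_scheme \<Rightarrow> 'a set \<Rightarrow> 'a \<Rightarrow> real" where
  "hecke_modular N N0 x = real (hecke_L N N0 x) / real (hecke_L N N0 (inv\<^bsub>N\<^esub> x))"

text \<open>
  A function on the group \<open>N\<close> is encoded as a function on the ambient type that vanishes outside
  \<open>carrier N\<close>, so that equality of such functions is equality on the carrier.
\<close>

definition hecke_functions :: "('a, 'm) monoid_scheme \<Rightarrow> 'a set \<Rightarrow> ('a \<Rightarrow> complex) set" where
  "hecke_functions N N0 = {f.
     (\<forall>x. x \<notin> carrier N \<longrightarrow> f x = 0) \<and>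
     (\<forall>x\<in>carrier N. \<forall>h\<in>N0. \<forall>k\<in>N0. f (h \<otimes>\<^bsub>N\<^esub> x \<otimes>\<^bsub>N\<^esub> k) = f x) \<and>
     finite (double_coset N N0 ` {x \<in> carrier N. f x \<noteq> 0})}"

text \<open>
  The convolution sum over \<open>N0 \ N\<close> is taken over the right cosets on which \<open>f2\<close> does not vanish;
  the others contribute zero, and for a Hecke pair only finitely many remain.
  The summand does not depend on the representative \<open>y\<close> of the coset \<open>C\<close>.
\<close>

definition hecke_conv ::
  "('a, 'm) monoid_scheme \<Rightarrow> 'a set \<Rightarrow> ('a \<Rightarrow> complex) \<Rightarrow> ('a \<Rightarrow> complex) \<Rightarrow> 'a \<Rightarrow> complex" where
  "hecke_conv N N0 f1 f2 = (\<lambda>x. if x \<in> carrier N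
     then \<Sum>C \<in> {C \<in> rcosets\<^bsub>N\<^esub> N0. \<exists>y\<in>C. f2 y \<noteq> 0}.
            (let y = (SOME y. y \<in> C) in f1 (x \<otimes>\<^bsub>N\<^esub> inv\<^bsub>N\<^esub> y) * f2 y)
     else 0)"

definition hecke_star :: "('a, 'm) monoid_scheme \<Rightarrow> ('a \<Rightarrow> complex) \<Rightarrow> 'a \<Rightarrow> complex" where
  "hecke_star N f = (\<lambda>x. if x \<in> carrier N then cnj (f (inv\<^bsub>N\<^esub> x)) else 0)"

definition hecke_algebra ::
  "('a, 'm) monoid_scheme \<Rightarrow> 'a set \<Rightarrow> (complex, 'a \<Rightarrow> complex) module" where
  "hecke_algebra N N0 =
     \<lparr>carrier = hecke_functions N N0,
      mult = hecke_conv N N0,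
      one = (\<lambda>x. if x \<in> N0 then 1 else 0),
      zero = (\<lambda>x. 0),
      add = (\<lambda>f1 f2 x. f1 x + f2 x),
      smult = (\<lambda>c f x. c * f x)\<rparr>"

definition function_action ::
  "('v, 'm) monoid_scheme \<Rightarrow> ('g, 'n) monoid_scheme \<Rightarrow> ('g \<Rightarrow> 'v \<Rightarrow> 'v) \<Rightarrow>
   'g \<Rightarrow> ('v \<Rightarrow> complex) \<Rightarrow> 'v \<Rightarrow> complex" where
  "function_action V G \<alpha> g f = (\<lambda>v. if v \<in> carrier V then f (\<alpha> (inv\<^bsub>G\<^esub> g) v) else 0)"

definition hecke_fixed_algebra ::
  "('v, 'm) monoid_scheme \<Rightarrow> 'v set \<Rightarrow> ('g, 'n) monoid_scheme \<Rightarrow> 'g set \<Rightarrow> ('g \<Rightarrow> 'v \<Rightarrow> 'v) \<Rightarrow>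
   (complex, 'v \<Rightarrow> complex) module" where
  "hecke_fixed_algebra V V0 G \<Gamma> \<alpha> =
     (hecke_algebra V V0)
       \<lparr>carrier := {f \<in> hecke_functions V V0. \<forall>\<gamma>\<in>\<Gamma>. function_action V G \<alpha> \<gamma> f = f}\<rparr>"

definition star_algebra_embedding ::
  "(complex, 'a) module \<Rightarrow> ('a \<Rightarrow> 'a) \<Rightarrow> (complex, 'b) module \<Rightarrow> ('b \<Rightarrow> 'b) \<Rightarrow> ('a \<Rightarrow> 'b) \<Rightarrow> bool" where
  "star_algebra_embedding A starA B starB \<phi> \<longleftrightarrow>
     \<phi> \<in> ring_hom A B \<and>
     (\<forall>c. \<forall>a\<in>carrier A. \<phi> (c \<odot>\<^bsub>A\<^esub> a) = c \<odot>\<^bsub>B\<^esub> \<phi> a) \<and>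
     (\<forall>a\<in>carrier A. \<phi> (starA a) = starB (\<phi> a)) \<and>
     inj_on \<phi> (carrier A)"

text \<open>The subgroup \<open>V0 \<rtimes> \<Gamma>\<close> of \<open>V \<rtimes> G\<close> is the subset \<open>V0 \<times> \<Gamma>\<close> of its carrier.\<close>

definition semidirect ::
  "('v, 'm) monoid_scheme \<Rightarrow> ('g, 'n) monoid_scheme \<Rightarrow> ('g \<Rightarrow> 'v \<Rightarrow> 'v) \<Rightarrow> ('v \<times> 'g) monoid" where
  "semidirect V G \<alpha> =
     \<lparr>carrier = carrier V \<times> carrier G,
      mult = (\<lambda>(v, g) (w, h). (v \<otimes>\<^bsub>V\<^esub> \<alpha> g w, g \<otimes>\<^bsub>G\<^esub> h)),
      one = (\<one>\<^bsub>V\<^esub>, \<one>\<^bsub>G\<^esub>)\<rparr>"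

definition subgroup_orbit ::
  "('g, 'n) monoid_scheme \<Rightarrow> 'g set \<Rightarrow> ('g \<Rightarrow> 'x \<Rightarrow> 'x) \<Rightarrow> 'x \<Rightarrow> 'x set" where
  "subgroup_orbit G H \<alpha> x = orbit (G\<lparr>carrier := H\<rparr>) \<alpha> x"

definition finite_orbits_on_double_cosets ::
  "('v, 'm) monoid_scheme \<Rightarrow> 'v set \<Rightarrow> ('g, 'n) monoid_scheme \<Rightarrow> 'g set \<Rightarrow> ('g \<Rightarrow> 'v \<Rightarrow> 'v) \<Rightarrow> bool" where
  "finite_orbits_on_double_cosets V V0 G \<Gamma> \<alpha> \<longleftrightarrow>
     (\<forall>D\<in>double_cosets V V0. finite (subgroup_orbit G \<Gamma> (\<lambda>\<gamma> S. \<alpha> \<gamma> ` S) D))"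

end

theory Submission
  imports Defs "HOL-Library.Equipollence"
begin

text \<open>
  Write \<open>N0 = V0 \<times> \<Gamma>\<close>, let \<open>g\<close> act on \<open>V\<close> through \<open>\<alpha>\<close>, and let
  \<open>\<Gamma>\<^sub>g = \<Gamma> \<inter> g \<Gamma> g\<^sup>-\<^sup>1\<close>. Everything about the Hecke condition rests on one decomposition of the
  left cosets of \<open>N0\<close> in \<open>N0 (v, g) N0\<close>. The projection to \<open>G\<close> maps them onto the left cosets of
  \<open>\<Gamma>\<close> in \<open>\<Gamma> g \<Gamma>\<close>, and each fibre is in bijection with \<open>S / g(V0)\<close>, where
  \<open>S = V0 O g(V0)\<close> and \<open>O\<close> is the \<open>\<Gamma>\<^sub>g\<close>-orbit of \<open>v\<close> (lemma \<open>left_cosets_semidirect\<close>). This is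
  the formula for \<open>L\<close>; applied to \<open>(v, g)\<^sup>-\<^sup>1\<close>, it becomes the formula for \<open>R\<close>.

  The decomposition is a bijection between possibly infinite sets. It therefore also shows that
  \<open>N0\<close> is a Hecke subgroup exactly when \<open>\<Gamma>\<close> is one and all the sets \<open>S / g(V0)\<close> are finite. The special cases \<open>g = 1\<close> and
  \<open>v = 1\<close> of this finiteness are the conditions on \<open>V0\<close>. Conversely, those conditions suffice,
  because \<open>V0 \<Gamma>(v) V0\<close> is covered by finitely many left cosets of \<open>V0\<close>, and each of
  these by finitely many left cosets of \<open>g(V0)\<close>.

  For the modular function, \<open>S\<close> is a union of double cosets \<open>V0 w g(V0)\<close>, \<open>w \<in> O\<close>. In each of them
  the number of left cosets divided by the number of right cosets is the relative index
  \<open>[V0 : w g(V0) w\<^sup>-\<^sup>1]\<close>. The relative index of commensurable subgroups is multiplicative, so this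
  is \<open>[V0 : w V0 w\<^sup>-\<^sup>1] [V0 : g(V0)]\<close>. The first factor is the modular function of \<open>V0\<close> at
  \<open>w\<close>, which equals that at \<open>v\<close> because \<open>w = \<delta>(v)\<close> with \<open>\<delta> \<in> \<Gamma>\<close>, and \<open>\<Gamma>\<close> preserves \<open>V0\<close>.

  The embedding extends a \<open>\<Gamma>\<close>-invariant function from \<open>V\<close> to \<open>V \<times> \<Gamma>\<close> constantly in the second
  variable, and by zero to the rest. It respects convolution because right cosets of \<open>V0\<close> in
  \<open>V\<close> correspond to right cosets of \<open>N0\<close> in \<open>V \<times> \<Gamma>\<close>, by \<open>V0 w \<mapsto> N0 (w, g)\<close> for any fixed
  \<open>g \<in> \<Gamma>\<close> (lemma \<open>hecke_extension_conv\<close>).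
\<close>

section \<open>Cosets and indices\<close>

lemma transversal_exists: obtains T where "T \<subseteq> S" "inj_on f T" "f ` T = f ` S"
  using subset_image_inj[of "f ` S" f S] by auto

text \<open>
  The bijections between sets of cosets below compare families indexed by the same set. Such families
  are equinumerous as soon as two indices give equal cosets on one side exactly when they do on the
  other. Working with equipollence instead of cardinalities settles finiteness and counting in
  one step.
\<close>

lemma eqpoll_same_kernel:
  assumes "\<And>s t. s \<in> S \<Longrightarrow> t \<in> S \<Longrightarrow> f s = f t \<longleftrightarrow> g s = g t"
  shows "f ` S \<approx> g ` S"
proof -
  have "bij_betw (\<lambda>x. g (inv_into S f x)) (f ` S) (g ` S)"
  proof (rule bij_betw_imageI)
    show "inj_on (\<lambda>x. g (inv_into S f x)) (f ` S)"
      by (rule inj_onI) (metis assms f_inv_into_f inv_into_into)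
    have "g (inv_into S f (f s)) = g s" if "s \<in> S" for s
      using assms that by (metis f_inv_into_f imageI inv_into_into)
    then show "(\<lambda>x. g (inv_into S f x)) ` f ` S = g ` S"
      by (simp add: image_image)
  qed
  then show ?thesis
    unfolding eqpoll_def by blast
qed

text \<open>
  The convolution sums over right cosets of \<open>V0\<close> and of \<open>V0 \<times> \<Gamma>\<close> are compared by
  this reindexing: both run over the same representatives with the same coincidences.
\<close>

lemma sum_same_kernel:
  assumes kernel: "\<And>s t. s \<in> S \<Longrightarrow> t \<in> S \<Longrightarrow> f s = f t \<longleftrightarrow> g s = g t"
    and agree: "\<And>s. s \<in> S \<Longrightarrow> h (f s) = k (g s)"
  shows "sum h (f ` S) = sum k (g ` S)"
proof -
  obtain T where T: "T \<subseteq> S" "inj_on f T" "f ` T = f ` S"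
    by (rule transversal_exists)
  have "inj_on g T" using T(1,2) kernel by (meson inj_on_def subsetD)
  moreover have "g ` T = g ` S"
  proof
    show "g ` T \<subseteq> g ` S" using T(1) by (rule image_mono)
    show "g ` S \<subseteq> g ` T"
    proof (rule image_subsetI)
      fix s assume s: "s \<in> S"
      then have "f s \<in> f ` T" using T(3) by simp
      then obtain t where "t \<in> T" "f s = f t" by blast
      then show "g s \<in> g ` T" using kernel[of s t] s T(1) by auto
    qed
  qed
  ultimately have "sum k (g ` S) = (\<Sum>t\<in>T. k (g t))" by (metis (no_types, lifting) sum.reindex_cong)
  also have "\<dots> = (\<Sum>t\<in>T. h (f t))" using T(1) agree by (intro sum.cong) auto
  also have "\<dots> = sum h (f ` S)" unfolding T(3)[symmetric] using T(2) by (simp add: sum.reindex)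
  finally show ?thesis ..
qed

lemma eqpoll_card_eq: "A \<approx> B \<Longrightarrow> card A = card B"
  unfolding eqpoll_def using bij_betw_same_card by blast

context group
begin

lemma l_coset_eq_iff:
  assumes "subgroup K G" "x \<in> carrier G" "y \<in> carrier G"
  shows "x <# K = y <# K \<longleftrightarrow> inv x \<otimes> y \<in> K"
proof
  assume "x <# K = y <# K"
  then have "y \<in> x <# K"
    using assms by (metis (no_types, lifting) l_coset_def UN_iff insertI1 r_one subgroup.one_closed)
  then obtain k where "k \<in> K" "y = x \<otimes> k" by (auto simp: l_coset_def)
  then show "inv x \<otimes> y \<in> K"
    using assms by (metis inv_solve_left subgroup.mem_carrier)
next
  assume "inv x \<otimes> y \<in> K"
  then show "x <# K = y <# K"
    using assms subgroup.lcos_module_rev[OF assms(1) is_group assms(2,3)] l_repr_independence by blast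
qed

lemma r_coset_eq_iff:
  assumes "subgroup K G" "x \<in> carrier G" "y \<in> carrier G"
  shows "K #> x = K #> y \<longleftrightarrow> x \<otimes> inv y \<in> K"
proof
  assume "K #> x = K #> y"
  then show "x \<otimes> inv y \<in> K"
    using assms by (metis coset_join1 coset_mult_assoc coset_mult_inv2 inv_closed m_closed subgroup.subset)
next
  assume "x \<otimes> inv y \<in> K"
  then show "K #> x = K #> y"
    using assms by (metis coset_join2 coset_mult_inv1 inv_closed m_closed subgroup.subset)
qed

lemma mem_conj_subgroup_iff:
  assumes "H \<subseteq> carrier G" "x \<in> carrier G"
  shows "y \<in> conj_subgroup G x H \<longleftrightarrow> y \<in> carrier G \<and> inv x \<otimes> y \<otimes> x \<in> H"
proof
  assume "y \<in> conj_subgroup G x H"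
  then obtain h where h: "h \<in> H" "y = x \<otimes> h \<otimes> inv x"
    by (auto simp: conj_subgroup_def l_coset_def r_coset_def)
  moreover have "inv x \<otimes> y \<otimes> x = h"
    using h assms by (simp add: m_assoc subset_iff) (simp flip: m_assoc)
  ultimately show "y \<in> carrier G \<and> inv x \<otimes> y \<otimes> x \<in> H"
    using assms by auto
next
  assume y: "y \<in> carrier G \<and> inv x \<otimes> y \<otimes> x \<in> H"
  then have "y = x \<otimes> (inv x \<otimes> y \<otimes> x) \<otimes> inv x"
    using assms by (simp add: m_assoc) (simp flip: m_assoc)
  then show "y \<in> conj_subgroup G x H"
    using y by (force simp: conj_subgroup_def l_coset_def r_coset_def)
qed

lemma conj_subgroup_image:
  "conj_subgroup G x H = (\<lambda>h. x \<otimes> h \<otimes> inv x) ` H"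
  by (auto simp: conj_subgroup_def l_coset_def r_coset_def)

lemma conj_subgroup_is_subgroup:
  assumes "subgroup H G" "x \<in> carrier G"
  shows "subgroup (conj_subgroup G x H) G"
proof -
  have H: "H \<subseteq> carrier G" using assms by (simp add: subgroup.subset)
  note mem = mem_conj_subgroup_iff[OF H assms(2)]
  show ?thesis
  proof (rule subgroupI)
    show "conj_subgroup G x H \<subseteq> carrier G" using mem by blast
    show "conj_subgroup G x H \<noteq> {}"
      using subgroup.one_closed[OF assms(1)] by (auto simp: conj_subgroup_image)
    show "inv a \<in> conj_subgroup G x H" if "a \<in> conj_subgroup G x H" for a
    proof -
      have "inv x \<otimes> inv a \<otimes> x = inv (inv x \<otimes> a \<otimes> x)"
        using that assms(2) by (simp add: mem inv_mult_group m_assoc)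
      then show ?thesis using that assms by (simp add: mem subgroup.m_inv_closed)
    qed
    show "a \<otimes> b \<in> conj_subgroup G x H"
      if "a \<in> conj_subgroup G x H" "b \<in> conj_subgroup G x H" for a b
    proof -
      have ab: "a \<in> carrier G" "b \<in> carrier G" using that by (simp_all add: mem)
      have "inv x \<otimes> (a \<otimes> b) \<otimes> x = (inv x \<otimes> a \<otimes> x) \<otimes> (inv x \<otimes> b \<otimes> x)"
        using ab assms(2) by (simp add: m_assoc) (simp flip: m_assoc)
      then show ?thesis using that ab assms(1) by (simp add: mem subgroup.m_closed)
    qed
  qed
qed

lemma double_coset_eq_image: "(H #> x) <#> K = (\<lambda>(h,k). h \<otimes> x \<otimes> k) ` (H \<times> K)"
  by (force simp: r_coset_def set_mult_def)

lemma m_inv_image_subgroup: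
  assumes "subgroup A G" shows "m_inv G ` A = A"
proof (intro equalityI subsetI)
  fix x assume "x \<in> A"
  then show "x \<in> m_inv G ` A"
    using assms by (intro image_eqI[of _ _ "inv x"]) (simp_all add: subgroup.m_inv_closed subgroup.mem_carrier)
qed (use assms in \<open>auto simp: subgroup.m_inv_closed\<close>)

lemma left_cosets_of_set_mult:
  assumes "subgroup K G" "S \<subseteq> carrier G"
  shows "left_cosets_of G (S <#> K) K = left_cosets_of G S K"
proof -
  have K: "K \<subseteq> carrier G" using assms by (simp add: subgroup.subset)
  have "(s \<otimes> k) <# K = s <# K" if "k \<in> K" "s \<in> S" for k s
    by (metis K assms coset_join3 lcos_m_assoc subsetD that)
  moreover have "s \<in> S <#> K" if "s \<in> S" for s
    using that assms by (force simp: set_mult_def dest: subgroup.one_closed)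
  ultimately show ?thesis
    unfolding left_cosets_of_def
    by (intro equalityI image_subsetI) (auto simp: set_mult_def intro: rev_image_eqI)
qed

text \<open>
  Writing an element of \<open>A\<close> as \<open>t b\<close>, with \<open>t\<close> from a transversal of \<open>A / B\<close>,
  identifies its \<open>C\<close>-coset with the pair of the \<open>B\<close>-coset of \<open>t\<close> and the \<open>C\<close>-coset
  of \<open>b\<close>.
\<close>

lemma index_tower:
  assumes "subgroup A G" "subgroup B G" "subgroup C G" "C \<subseteq> B" "B \<subseteq> A"
  shows "left_cosets_of G A C \<approx> left_cosets_of G A B \<times> left_cosets_of G B C"
proof -
  have car: "A \<subseteq> carrier G" "B \<subseteq> carrier G" using assms by (simp_all add: subgroup.subset)
  obtain T where T: "T \<subseteq> A" "inj_on (\<lambda>x. x <# B) T" "(\<lambda>x. x <# B) ` T = (\<lambda>x. x <# B) ` A"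
    by (rule transversal_exists)
  have A: "A = (\<lambda>(t,b). t \<otimes> b) ` (T \<times> B)"
  proof (intro equalityI subsetI)
    fix a assume a: "a \<in> A"
    then obtain t where t: "t \<in> T" "t <# B = a <# B" using T(3) by (metis (no_types, lifting) imageE imageI)
    have tac: "t \<in> carrier G" "a \<in> carrier G" using a t(1) T(1) car by auto
    then have "inv t \<otimes> a \<in> B" using t(2) l_coset_eq_iff[OF assms(2)] by simp
    moreover have "a = t \<otimes> (inv t \<otimes> a)" using tac by (simp flip: m_assoc)
    ultimately show "a \<in> (\<lambda>(t,b). t \<otimes> b) ` (T \<times> B)" using t by (auto intro!: image_eqI[of _ _ "(t, inv t \<otimes> a)"])
  next
    fix a assume "a \<in> (\<lambda>(t,b). t \<otimes> b) ` (T \<times> B)"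
    then show "a \<in> A" using T(1) assms by (auto intro: subgroup.m_closed)
  qed
  have "left_cosets_of G A C = (\<lambda>(t,b). (t \<otimes> b) <# C) ` (T \<times> B)"
    unfolding left_cosets_of_def by (subst A) (simp add: image_image case_prod_unfold)
  also have "\<dots> \<approx> (\<lambda>(t,b). (t <# B, b <# C)) ` (T \<times> B)"
  proof (rule eqpoll_same_kernel, clarify)
    fix t b t' b' assume h: "t \<in> T" "b \<in> B" "t' \<in> T" "b' \<in> B"
    have hc: "t \<in> carrier G" "b \<in> carrier G" "t' \<in> carrier G" "b' \<in> carrier G"
      using h T(1) car by auto
    have same: "inv (t \<otimes> b) \<otimes> (t \<otimes> b') = inv b \<otimes> b'"
      using hc by (simp add: inv_mult_group m_assoc) (simp flip: m_assoc)
    have step: "t <# B = t' <# B" if "inv (t \<otimes> b) \<otimes> (t' \<otimes> b') \<in> C"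
    proof -
      have "inv t \<otimes> t' = b \<otimes> (inv (t \<otimes> b) \<otimes> (t' \<otimes> b')) \<otimes> inv b'"
        using hc by (simp add: inv_mult_group m_assoc) (simp flip: m_assoc)
      also have "\<dots> \<in> B"
        using that h assms by (meson subgroup.m_closed subgroup.m_inv_closed subsetD)
      finally show ?thesis using hc l_coset_eq_iff[OF assms(2)] by blast
    qed
    have 1: "(t \<otimes> b) <# C = (t' \<otimes> b') <# C \<longleftrightarrow> inv (t \<otimes> b) \<otimes> (t' \<otimes> b') \<in> C"
      using hc by (simp add: l_coset_eq_iff[OF assms(3)])
    have 2: "b <# C = b' <# C \<longleftrightarrow> inv b \<otimes> b' \<in> C"
      using hc by (simp add: l_coset_eq_iff[OF assms(3)])
    show "((t \<otimes> b) <# C = (t' \<otimes> b') <# C) = ((t <# B, b <# C) = (t' <# B, b' <# C))"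
      unfolding prod.inject 1 2 using step same inj_onD[OF T(2), of t t'] h by metis
  qed
  also have "(\<lambda>(t,b). (t <# B, b <# C)) ` (T \<times> B) = left_cosets_of G A B \<times> left_cosets_of G B C"
    unfolding left_cosets_of_def T(3)[symmetric] by auto
  finally show ?thesis .
qed

lemma sub_index_pos:
  assumes "subgroup A G" "finite_index G A B" shows "sub_index G A B > 0"
  using assms subgroup.one_closed[OF assms(1)]
  by (auto simp: finite_index_def sub_index_def left_cosets_of_def card_gt_0_iff)

lemma sub_index_tower:
  assumes "subgroup A G" "subgroup B G" "subgroup C G" "C \<subseteq> B" "B \<subseteq> A"
  shows "sub_index G A C = sub_index G A B * sub_index G B C"
  using eqpoll_card_eq[OF index_tower[OF assms]] by (simp add: sub_index_def card_cartesian_product)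

lemma finite_index_tower:
  assumes "subgroup A G" "subgroup B G" "subgroup C G" "C \<subseteq> B" "B \<subseteq> A"
    "finite_index G A B" "finite_index G B C"
  shows "finite_index G A C"
  using eqpoll_finite_iff[OF index_tower[OF assms(1-5)]] assms(6,7) by (simp add: finite_index_def)

lemma left_cosets_of_Int:
  assumes "subgroup A G" "subgroup C G"
  shows "left_cosets_of G A (A \<inter> C) \<approx> left_cosets_of G A C"
  unfolding left_cosets_of_def
proof (rule eqpoll_same_kernel)
  have AC: "subgroup (A \<inter> C) G" using assms subgroups_Inter_pair by blast
  fix s t assume "s \<in> A" "t \<in> A"
  moreover from this have "s \<in> carrier G" "t \<in> carrier G" "inv s \<otimes> t \<in> A"
    using assms(1) by (simp_all add: subgroup.mem_carrier subgroup.m_closed subgroup.m_inv_closed)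
  ultimately show "s <# (A \<inter> C) = t <# (A \<inter> C) \<longleftrightarrow> s <# C = t <# C"
    by (simp add: l_coset_eq_iff[OF AC] l_coset_eq_iff[OF assms(2)])
qed

lemma finite_index_Int_iff:
  assumes "subgroup A G" "subgroup C G"
  shows "finite_index G A (A \<inter> C) \<longleftrightarrow> finite (left_cosets_of G A C)"
  using left_cosets_of_Int[OF assms] by (simp add: finite_index_def eqpoll_finite_iff)

lemma finite_index_Int:
  assumes "subgroup A G" "subgroup C G" "A \<subseteq> B" "finite_index G B C"
  shows "finite_index G A (A \<inter> C)"
  unfolding finite_index_Int_iff[OF assms(1,2)]
  using assms(3,4) unfolding finite_index_def left_cosets_of_def
  by (meson finite_subset image_mono)

text \<open>
  If \<open>S\<close> lies in finitely many cosets \<open>t H\<close> and \<open>H\<close> meets finitely many cosets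
  \<open>h K\<close>, then \<open>S\<close> meets only the finitely many cosets \<open>t h K\<close>. The relevant case is
  \<open>H = V0\<close> and \<open>K = g(V0)\<close>.
\<close>

lemma finite_left_cosets_trans:
  assumes "subgroup H G" "K \<subseteq> carrier G" "S \<subseteq> carrier G"
    and "finite (left_cosets_of G S H)" "finite (left_cosets_of G H K)"
  shows "finite (left_cosets_of G S K)"
proof -
  obtain T where T: "T \<subseteq> S" "inj_on (\<lambda>x. x <# H) T" "(\<lambda>x. x <# H) ` T = (\<lambda>x. x <# H) ` S"
    by (rule transversal_exists)
  have "left_cosets_of G S K \<subseteq> (\<lambda>(t, C). t <# C) ` (T \<times> left_cosets_of G H K)"
  proof
    fix C assume "C \<in> left_cosets_of G S K"
    then obtain s where s: "s \<in> S" "C = s <# K" by (auto simp: left_cosets_of_def)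
    then have "s <# H \<in> (\<lambda>x. x <# H) ` T" unfolding T(3) by simp
    then obtain t where t: "t \<in> T" "t <# H = s <# H" by force
    have car: "s \<in> carrier G" "t \<in> carrier G" using s t T(1) assms(3) by auto
    have h: "inv t \<otimes> s \<in> H" using t(2) l_coset_eq_iff[OF assms(1)] car by simp
    moreover have "t <# ((inv t \<otimes> s) <# K) = C"
      using car assms(2) s(2) by (simp add: lcos_m_assoc flip: m_assoc)
    ultimately show "C \<in> (\<lambda>(t, C). t <# C) ` (T \<times> left_cosets_of G H K)"
      using t(1) by (auto simp: left_cosets_of_def intro!: image_eqI[of _ _ "(t, (inv t \<otimes> s) <# K)"])
  qed
  moreover have "finite T"
    using assms(4) T(2,3) unfolding left_cosets_of_def by (metis finite_imageD)
  ultimately show ?thesis using assms(5) by (meson finite_SigmaI finite_imageI finite_subset)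
qed

lemma finite_index_supergroup:
  assumes "subgroup A G" "subgroup B G" "subgroup C G" "C \<subseteq> B" "B \<subseteq> A" "finite_index G A C"
  shows "finite_index G A B"
proof -
  have "left_cosets_of G A B \<times> left_cosets_of G B C \<approx> left_cosets_of G A C"
    using index_tower[OF assms(1-5)] eqpoll_sym by blast
  moreover have "left_cosets_of G B C \<noteq> {}"
    using subgroup.one_closed[OF assms(2)] by (auto simp: left_cosets_of_def)
  ultimately show ?thesis
    using assms(6) unfolding finite_index_def
    by (metis eqpoll_finite_iff finite_cartesian_productD1)
qed

text \<open>
  The orbit-stabilizer bijection for \<open>H\<close> acting on the cosets of \<open>K\<close>: the stabilizer of
  \<open>x K\<close> is \<open>H \<inter> x K x\<^sup>-\<^sup>1\<close>, and its orbit is the double coset \<open>H x K\<close> modulo \<open>K\<close>.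
\<close>

lemma left_cosets_of_double_coset:
  assumes "subgroup H G" "subgroup K G" "x \<in> carrier G"
  shows "left_cosets_of G H (H \<inter> conj_subgroup G x K) \<approx> left_cosets_of G ((H #> x) <#> K) K"
proof -
  have car: "H \<subseteq> carrier G" "K \<subseteq> carrier G" using assms by (simp_all add: subgroup.subset)
  have sub: "subgroup (H \<inter> conj_subgroup G x K) G"
    using assms conj_subgroup_is_subgroup subgroups_Inter_pair by blast
  have "left_cosets_of G H (H \<inter> conj_subgroup G x K) \<approx> (\<lambda>h. (h \<otimes> x) <# K) ` H"
    unfolding left_cosets_of_def
  proof (rule eqpoll_same_kernel)
    fix s t assume st: "s \<in> H" "t \<in> H"
    then have stc: "s \<in> carrier G" "t \<in> carrier G" using car by auto
    have "inv s \<otimes> t \<in> H" using st assms by (simp add: subgroup.m_closed subgroup.m_inv_closed)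
    moreover have "inv (s \<otimes> x) \<otimes> (t \<otimes> x) = inv x \<otimes> (inv s \<otimes> t) \<otimes> x"
      using stc assms(3) by (simp add: inv_mult_group m_assoc)
    ultimately show "s <# (H \<inter> conj_subgroup G x K) = t <# (H \<inter> conj_subgroup G x K) \<longleftrightarrow>
        (s \<otimes> x) <# K = (t \<otimes> x) <# K"
      using stc assms(3)
      by (simp add: l_coset_eq_iff[OF sub] l_coset_eq_iff[OF assms(2)] mem_conj_subgroup_iff[OF car(2)])
  qed
  also have "(\<lambda>h. (h \<otimes> x) <# K) ` H = left_cosets_of G (H #> x) K"
    by (auto simp: left_cosets_of_def r_coset_def)
  also have "\<dots> = left_cosets_of G ((H #> x) <#> K) K"
    using car assms(3) by (simp add: left_cosets_of_set_mult[OF assms(2)] r_coset_subset_G)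
  finally show ?thesis .
qed

lemma right_cosets_eqpoll_left_cosets:
  assumes "subgroup K G" "S \<subseteq> carrier G"
  shows "right_cosets_of G K S \<approx> left_cosets_of G (m_inv G ` S) K"
  unfolding right_cosets_of_def left_cosets_of_def image_image
proof (rule eqpoll_same_kernel)
  fix s t assume "s \<in> S" "t \<in> S"
  then have st: "s \<in> carrier G" "t \<in> carrier G" using assms by auto
  then show "K #> s = K #> t \<longleftrightarrow> inv s <# K = inv t <# K"
    using assms(1) by (simp add: l_coset_eq_iff r_coset_eq_iff)
qed

text \<open>
  Inversion turns \<open>H x K\<close> into \<open>K x\<^sup>-\<^sup>1 H\<close> and exchanges right and left cosets of
  \<open>H\<close>.
\<close>

lemma right_cosets_of_double_coset:
  assumes "subgroup H G" "subgroup K G" "x \<in> carrier G"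
  shows "right_cosets_of G H ((H #> x) <#> K) \<approx> left_cosets_of G K (K \<inter> conj_subgroup G (inv x) H)"
proof -
  have car: "H \<subseteq> carrier G" "K \<subseteq> carrier G" using assms by (simp_all add: subgroup.subset)
  have "m_inv G ` ((H #> x) <#> K) = (\<lambda>(h,k). inv (h \<otimes> x \<otimes> k)) ` (H \<times> K)"
    unfolding double_coset_eq_image image_image by (simp add: case_prod_unfold)
  also have "\<dots> = (\<lambda>(h,k). inv k \<otimes> inv x \<otimes> inv h) ` (H \<times> K)"
    using car assms(3) by (intro image_cong) (auto simp: inv_mult_group m_assoc subset_iff)
  also have "\<dots> = (\<lambda>(k,h). k \<otimes> inv x \<otimes> h) ` ((\<lambda>(h,k). (inv k, inv h)) ` (H \<times> K))"
    by (simp add: image_image case_prod_unfold)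
  also have "(\<lambda>(h,k). (inv k, inv h)) ` (H \<times> K) = (m_inv G ` K) \<times> (m_inv G ` H)" by auto
  also have "(\<lambda>(k,h). k \<otimes> inv x \<otimes> h) ` ((m_inv G ` K) \<times> (m_inv G ` H)) = (K #> inv x) <#> H"
    unfolding m_inv_image_subgroup[OF assms(1)] m_inv_image_subgroup[OF assms(2)]
    double_coset_eq_image ..
  finally have "m_inv G ` ((H #> x) <#> K) = (K #> inv x) <#> H" .
  then have "right_cosets_of G H ((H #> x) <#> K) \<approx> left_cosets_of G ((K #> inv x) <#> H) H"
    using right_cosets_eqpoll_left_cosets[OF assms(1), of "(H #> x) <#> K"] car assms(3)
    by (simp add: set_mult_closed r_coset_subset_G)
  then show ?thesis
    using left_cosets_of_double_coset[OF assms(2,1), of "inv x"] assms(3)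
    by (meson eqpoll_sym eqpoll_trans inv_closed)
qed

lemma left_cosets_of_automorphism:
  assumes f: "f \<in> hom G G" "inj_on f (carrier G)" and "subgroup K G" "S \<subseteq> carrier G"
  shows "left_cosets_of G (f ` S) (f ` K) \<approx> left_cosets_of G S K"
proof -
  interpret f: group_hom G G f using f(1) by unfold_locales
  have sub: "subgroup (f ` K) G" using assms(3) by (rule f.subgroup_img_is_subgroup)
  have "left_cosets_of G (f ` S) (f ` K) = (\<lambda>s. f s <# (f ` K)) ` S"
    by (simp add: left_cosets_of_def image_image)
  also have "\<dots> \<approx> left_cosets_of G S K"
    unfolding left_cosets_of_def
  proof (rule eqpoll_same_kernel)
    fix s t assume "s \<in> S" "t \<in> S"
    then have st: "s \<in> carrier G" "t \<in> carrier G" using assms by auto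
    have "inv (f s) \<otimes> f t = f (inv s \<otimes> t)" using st by simp
    then show "f s <# (f ` K) = f t <# (f ` K) \<longleftrightarrow> s <# K = t <# K"
      using st inj_on_image_mem_iff[OF f(2), of "inv s \<otimes> t" K] assms(3)
      by (simp add: l_coset_eq_iff sub subgroup.subset)
  qed
  finally show ?thesis .
qed

lemma sub_index_automorphism:
  assumes f: "f \<in> hom G G" "inj_on f (carrier G)" and "subgroup A G" "subgroup B G"
  shows "sub_index G (f ` A) (f ` A \<inter> f ` B) = sub_index G A (A \<inter> B)"
    and "finite_index G (f ` A) (f ` A \<inter> f ` B) \<longleftrightarrow> finite_index G A (A \<inter> B)"
proof -
  have AB: "subgroup (A \<inter> B) G" using assms subgroups_Inter_pair by blast
  have "f ` (A \<inter> B) = f ` A \<inter> f ` B"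
    using f(2) assms(3,4) by (meson inj_on_image_Int subgroup.subset)
  then have "left_cosets_of G (f ` A) (f ` A \<inter> f ` B) \<approx> left_cosets_of G A (A \<inter> B)"
    using left_cosets_of_automorphism[OF f AB subgroup.subset[OF assms(3)]] by simp
  then show "sub_index G (f ` A) (f ` A \<inter> f ` B) = sub_index G A (A \<inter> B)"
    and "finite_index G (f ` A) (f ` A \<inter> f ` B) \<longleftrightarrow> finite_index G A (A \<inter> B)"
    by (simp_all add: sub_index_def finite_index_def eqpoll_card_eq eqpoll_finite_iff)
qed

lemma conj_hom:
  assumes "x \<in> carrier G"
  shows "(\<lambda>h. x \<otimes> h \<otimes> inv x) \<in> hom G G" "inj_on (\<lambda>h. x \<otimes> h \<otimes> inv x) (carrier G)"
proof -
  show "(\<lambda>h. x \<otimes> h \<otimes> inv x) \<in> hom G G"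
    using assms by (intro homI) (simp_all add: m_assoc, simp flip: m_assoc)
  show "inj_on (\<lambda>h. x \<otimes> h \<otimes> inv x) (carrier G)"
    using assms by (intro inj_onI) simp
qed

end

section \<open>Relative index of commensurable subgroups\<close>

text \<open>
  The generalized index \<open>[A : B]\<close> of commensurable subgroups. It is meaningful only when both
  indices are finite: an infinite index is counted as zero.
\<close>

definition relative_index :: "('a, 'm) monoid_scheme \<Rightarrow> 'a set \<Rightarrow> 'a set \<Rightarrow> real" where
  "relative_index N A B = real (sub_index N A (A \<inter> B)) / real (sub_index N B (A \<inter> B))"

context group
begin

text \<open>
  The intersection \<open>A \<inter> B\<close> may be replaced by any subgroup of finite index in it, because the
  extra index cancels.
\<close>

lemma relative_index_subgroup:
  assumes "subgroup A G" "subgroup B G" "subgroup D G" "D \<subseteq> A \<inter> B"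
    "finite_index G A (A \<inter> B)" "finite_index G B (A \<inter> B)" "finite_index G (A \<inter> B) D"
  shows "relative_index G A B = real (sub_index G A D) / real (sub_index G B D)"
proof -
  have AB: "subgroup (A \<inter> B) G" using assms subgroups_Inter_pair by blast
  have "sub_index G A D = sub_index G A (A \<inter> B) * sub_index G (A \<inter> B) D"
    "sub_index G B D = sub_index G B (A \<inter> B) * sub_index G (A \<inter> B) D"
    using assms AB by (auto intro!: sub_index_tower)
  moreover have "sub_index G (A \<inter> B) D > 0" using AB assms(7) by (rule sub_index_pos)
  ultimately show ?thesis unfolding relative_index_def by simp
qed

text \<open>
  All three relative indices are computed with the common subgroup \<open>A \<inter> B \<inter> C\<close>, where
  multiplicativity is a cancellation of fractions.
\<close>

lemma commensurable_trans_relative_index: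
  assumes "subgroup A G" "subgroup B G" "subgroup C G" "commensurable G A B" "commensurable G B C"
  shows "commensurable G A C"
    and "relative_index G A C = relative_index G A B * relative_index G B C"
proof -
  define D where "D = A \<inter> B \<inter> C"
  have AB: "subgroup (A \<inter> B) G" and BC: "subgroup (B \<inter> C) G" and AC: "subgroup (A \<inter> C) G"
    using assms subgroups_Inter_pair by blast+
  have D: "subgroup D G" using AB assms subgroups_Inter_pair D_def by blast
  have fin: "finite_index G A (A \<inter> B)" "finite_index G B (A \<inter> B)"
    "finite_index G B (B \<inter> C)" "finite_index G C (B \<inter> C)"
    using assms(4,5) by (simp_all add: commensurable_def)
  have eqD: "(A \<inter> B) \<inter> (B \<inter> C) = D" "(B \<inter> C) \<inter> (A \<inter> B) = D" by (auto simp: D_def)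
  have fAB: "finite_index G (A \<inter> B) D"
    using finite_index_Int[OF AB BC _ fin(3)] by (simp add: eqD)
  have fBC: "finite_index G (B \<inter> C) D"
    using finite_index_Int[OF BC AB _ fin(2)] by (simp add: eqD)
  have fA: "finite_index G A D"
    by (rule finite_index_tower[OF assms(1) AB D _ _ fin(1) fAB]) (auto simp: D_def)
  have fB: "finite_index G B D"
    by (rule finite_index_tower[OF assms(2) AB D _ _ fin(2) fAB]) (auto simp: D_def)
  have fC: "finite_index G C D"
    by (rule finite_index_tower[OF assms(3) BC D _ _ fin(4) fBC]) (auto simp: D_def)
  show com: "commensurable G A C"
    unfolding commensurable_def
    using finite_index_supergroup[OF assms(1) AC D _ _ fA] finite_index_supergroup[OF assms(3) AC D _ _ fC]
    by (auto simp: D_def)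
  have fAC: "finite_index G (A \<inter> C) D"
    using finite_index_Int[OF AC AB _ fin(1)] by (simp add: D_def Int_ac)
  have 1: "relative_index G A B = real (sub_index G A D) / real (sub_index G B D)"
    by (rule relative_index_subgroup[OF assms(1,2) D _ fin(1,2) fAB]) (auto simp: D_def)
  have 2: "relative_index G B C = real (sub_index G B D) / real (sub_index G C D)"
    by (rule relative_index_subgroup[OF assms(2,3) D _ fin(3,4) fBC]) (auto simp: D_def)
  have 3: "relative_index G A C = real (sub_index G A D) / real (sub_index G C D)"
    using com by (intro relative_index_subgroup[OF assms(1,3) D _ _ _ fAC]) (auto simp: D_def commensurable_def)
  show "relative_index G A C = relative_index G A B * relative_index G B C"
    using sub_index_pos[OF assms(2) fB] by (simp add: 1 2 3)
qed

lemma relative_index_automorphism: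
  assumes "f \<in> hom G G" "inj_on f (carrier G)" "subgroup A G" "subgroup B G"
  shows "relative_index G (f ` A) (f ` B) = relative_index G A B"
    and "commensurable G (f ` A) (f ` B) \<longleftrightarrow> commensurable G A B"
  using sub_index_automorphism[OF assms] sub_index_automorphism[OF assms(1,2,4,3)]
  by (simp_all add: relative_index_def commensurable_def Int_commute)

lemma conj_subgroup_conj:
  assumes "H \<subseteq> carrier G" "x \<in> carrier G" "y \<in> carrier G"
  shows "conj_subgroup G x (conj_subgroup G y H) = conj_subgroup G (x \<otimes> y) H"
  unfolding conj_subgroup_image image_image
  using assms by (intro image_cong) (auto simp: m_assoc inv_mult_group subset_iff)

lemma conj_subgroup_one: "H \<subseteq> carrier G \<Longrightarrow> conj_subgroup G \<one> H = H"
  unfolding conj_subgroup_image by (force simp: subset_iff)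

text \<open>
  Conjugation by \<open>x\<close> maps the pair \<open>K\<close>, \<open>x\<^sup>-\<^sup>1 H x\<close> to the pair
  \<open>x K x\<^sup>-\<^sup>1\<close>, \<open>H\<close>.
\<close>

lemma sub_index_conj:
  assumes "subgroup H G" "subgroup K G" "x \<in> carrier G"
  shows "sub_index G K (K \<inter> conj_subgroup G (inv x) H)
      = sub_index G (conj_subgroup G x K) (H \<inter> conj_subgroup G x K)"
    and "finite_index G K (K \<inter> conj_subgroup G (inv x) H)
      \<longleftrightarrow> finite_index G (conj_subgroup G x K) (H \<inter> conj_subgroup G x K)"
proof -
  have "conj_subgroup G x (conj_subgroup G (inv x) H) = H"
    using assms by (simp add: conj_subgroup_conj conj_subgroup_one subgroup.subset)
  then show "sub_index G K (K \<inter> conj_subgroup G (inv x) H)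
      = sub_index G (conj_subgroup G x K) (H \<inter> conj_subgroup G x K)"
    and "finite_index G K (K \<inter> conj_subgroup G (inv x) H)
      \<longleftrightarrow> finite_index G (conj_subgroup G x K) (H \<inter> conj_subgroup G x K)"
    using sub_index_automorphism[OF conj_hom[OF assms(3)] assms(2) conj_subgroup_is_subgroup[OF assms(1)], of "inv x"] assms(3)
    by (simp_all add: conj_subgroup_image[symmetric] Int_commute)
qed

text \<open>
  The modular function measures how conjugation changes the size of \<open>H\<close>. In this form it
  can be combined with other subgroups by multiplicativity.
\<close>

lemma hecke_modular_eq_relative_index:
  assumes "subgroup H G" "x \<in> carrier G"
  shows "hecke_modular G H x = relative_index G H (conj_subgroup G x H)"
  using sub_index_conj(1)[OF assms(1,1,2)]
  by (simp add: hecke_modular_def hecke_L_def relative_index_def)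

lemma hecke_pair_commensurable:
  assumes "hecke_pair G H" "x \<in> carrier G"
  shows "commensurable G H (conj_subgroup G x H)"
proof -
  have H: "subgroup H G" using assms(1) by (simp add: hecke_pair_def)
  have "finite_index G H (H \<inter> conj_subgroup G x H)" "finite_index G H (H \<inter> conj_subgroup G (inv x) H)"
    using assms by (simp_all add: hecke_pair_def)
  then show ?thesis
    using sub_index_conj(2)[OF H H assms(2)] by (simp add: commensurable_def)
qed

text \<open>
  The numbers of left and right cosets in \<open>H x K\<close> are the two indices in the definition of
  the relative index of \<open>H\<close> and \<open>x K x\<^sup>-\<^sup>1\<close>.
\<close>

lemma card_double_coset_ratio:
  assumes "subgroup H G" "subgroup K G" "x \<in> carrier G" "commensurable G H (conj_subgroup G x K)"
  shows "real (card (left_cosets_of G ((H #> x) <#> K) K))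
    = relative_index G H (conj_subgroup G x K) * real (card (right_cosets_of G H ((H #> x) <#> K)))"
proof -
  have "card (left_cosets_of G ((H #> x) <#> K) K) = sub_index G H (H \<inter> conj_subgroup G x K)"
    using eqpoll_card_eq[OF left_cosets_of_double_coset[OF assms(1-3)]] by (simp add: sub_index_def)
  moreover have "card (right_cosets_of G H ((H #> x) <#> K))
      = sub_index G (conj_subgroup G x K) (H \<inter> conj_subgroup G x K)"
    using eqpoll_card_eq[OF right_cosets_of_double_coset[OF assms(1-3)]] sub_index_conj(1)[OF assms(1-3)]
    by (simp add: sub_index_def)
  moreover have "sub_index G (conj_subgroup G x K) (H \<inter> conj_subgroup G x K) > 0"
    using assms conj_subgroup_is_subgroup sub_index_pos by (simp add: commensurable_def)
  ultimately show ?thesis by (simp add: relative_index_def)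
qed

lemma double_coset_eqI:
  assumes "subgroup H G" "subgroup K G" "x \<in> carrier G" "y \<in> (H #> x) <#> K"
  shows "(H #> y) <#> K = (H #> x) <#> K"
proof -
  have car: "H \<subseteq> carrier G" "K \<subseteq> carrier G" using assms by (simp_all add: subgroup.subset)
  obtain h k where hk: "h \<in> H" "k \<in> K" "y = h \<otimes> x \<otimes> k"
    using assms(4) by (auto simp: double_coset_eq_image)
  then have hkc: "h \<in> carrier G" "k \<in> carrier G" using car by auto
  have "H #> y = H #> (x \<otimes> k)"
    using hk hkc assms coset_join2[OF hkc(1) assms(1) hk(1)] coset_mult_assoc[OF car(1) hkc(1), of "x \<otimes> k"]
    by (simp add: m_assoc)
  then have "(H #> y) <#> K = H <#> ((x \<otimes> k) <# K)"
    using hkc assms(3) car by (simp add: rcos_assoc_lcos)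
  also have "(x \<otimes> k) <# K = x <# K"
    using coset_join3[OF hkc(2) assms(2) hk(2)] lcos_m_assoc[OF car(2) assms(3) hkc(2)] by simp
  also have "H <#> (x <# K) = (H #> x) <#> K"
    using assms(3) car by (simp add: rcos_assoc_lcos)
  finally show ?thesis .
qed

lemma mem_double_coset_self:
  assumes "subgroup H G" "subgroup K G" "x \<in> carrier G"
  shows "x \<in> (H #> x) <#> K"
  using assms subgroup.one_closed[of H G] subgroup.one_closed[of K G]
  by (auto simp: double_coset_eq_image intro!: image_eqI[of _ _ "(\<one>,\<one>)"])

text \<open>
  A left coset \<open>C\<close> of \<open>K\<close> inside a double coset \<open>D\<close> recovers it as \<open>D = H C\<close>.
  Hence the coset sets of different double cosets are disjoint, and there are at most as many double
  cosets as left cosets.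
\<close>

lemma card_left_cosets_Union:
  assumes "subgroup H G" "subgroup K G" "X \<subseteq> carrier G"
    and S: "S = (\<Union>x\<in>X. (H #> x) <#> K)"
    and fin: "finite (left_cosets_of G S K)"
  shows "finite ((\<lambda>x. (H #> x) <#> K) ` X)"
    and "card (left_cosets_of G S K) = (\<Sum>D\<in>(\<lambda>x. (H #> x) <#> K) ` X. card (left_cosets_of G D K))"
proof -
  define DD where "DD = (\<lambda>x. (H #> x) <#> K) ` X"
  have car: "H \<subseteq> carrier G" "K \<subseteq> carrier G" using assms by (simp_all add: subgroup.subset)
  have det: "(H <#> C) = D" if DC: "D \<in> DD" "C \<in> left_cosets_of G D K" for C D
  proof -
    obtain x y where xy: "x \<in> X" "D = (H #> x) <#> K" "y \<in> D" "C = y <# K"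
      using DC unfolding DD_def left_cosets_of_def by blast
    have yc: "y \<in> carrier G"
      using xy assms(3) car by (metis r_coset_subset_G set_mult_closed subsetD)
    have "H <#> C = (H #> y) <#> K" using xy(4) yc car by (simp add: rcos_assoc_lcos)
    also have "\<dots> = D"
      using double_coset_eqI[OF assms(1,2), of x y] xy assms(3) by blast
    finally show ?thesis .
  qed
  have disj: "left_cosets_of G D K \<inter> left_cosets_of G D' K = {}" if "D \<in> DD" "D' \<in> DD" "D \<noteq> D'" for D D'
    using det[of D] det[of D'] that by fastforce
  have un: "left_cosets_of G S K = (\<Union>D\<in>DD. left_cosets_of G D K)"
    unfolding S DD_def left_cosets_of_def by auto
  have ne: "left_cosets_of G D K \<noteq> {}" if D: "D \<in> DD" for D
  proof -
    obtain x where "x \<in> X" "D = (H #> x) <#> K" using D by (auto simp: DD_def)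
    then have "x \<in> D" using assms(1-3) mem_double_coset_self by blast
    then show ?thesis by (auto simp: left_cosets_of_def)
  qed
  have "DD \<subseteq> (\<lambda>C. H <#> C) ` left_cosets_of G S K"
  proof
    fix D assume D: "D \<in> DD"
    then obtain C where "C \<in> left_cosets_of G D K" using ne by blast
    then show "D \<in> (\<lambda>C. H <#> C) ` left_cosets_of G S K" using D det un by (intro image_eqI[of _ _ C]) auto
  qed
  then show finDD: "finite DD" using fin finite_surj by blast
  have "finite (left_cosets_of G D K)" if "D \<in> DD" for D
    by (rule finite_subset[OF _ fin]) (use that un in blast)
  then show "card (left_cosets_of G S K) = (\<Sum>D\<in>DD. card (left_cosets_of G D K))"
    unfolding un using finDD disj by (intro card_UN_disjoint) auto
qed

lemma card_right_cosets_Union: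
  assumes "subgroup H G" "subgroup K G" "X \<subseteq> carrier G"
    and S: "S = (\<Union>x\<in>X. (H #> x) <#> K)"
    and fin: "finite (right_cosets_of G H S)"
    and finDD: "finite ((\<lambda>x. (H #> x) <#> K) ` X)"
  shows "card (right_cosets_of G H S) = (\<Sum>D\<in>(\<lambda>x. (H #> x) <#> K) ` X. card (right_cosets_of G H D))"
proof -
  define DD where "DD = (\<lambda>x. (H #> x) <#> K) ` X"
  have car: "H \<subseteq> carrier G" "K \<subseteq> carrier G" using assms by (simp_all add: subgroup.subset)
  have det: "(C <#> K) = D" if DC: "D \<in> DD" "C \<in> right_cosets_of G H D" for C D
  proof -
    obtain x y where xy: "x \<in> X" "D = (H #> x) <#> K" "y \<in> D" "C = H #> y"
      using DC unfolding DD_def right_cosets_of_def by blast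
    then show ?thesis
      using double_coset_eqI[OF assms(1,2), of x y] assms(3) by blast
  qed
  have disj: "right_cosets_of G H D \<inter> right_cosets_of G H D' = {}" if "D \<in> DD" "D' \<in> DD" "D \<noteq> D'" for D D'
    using det[of D] det[of D'] that by fastforce
  have un: "right_cosets_of G H S = (\<Union>D\<in>DD. right_cosets_of G H D)"
    unfolding S DD_def right_cosets_of_def by auto
  moreover have "finite (right_cosets_of G H D)" if "D \<in> DD" for D
    by (rule finite_subset[OF _ fin]) (use that un in blast)
  ultimately show "card (right_cosets_of G H S) = (\<Sum>D\<in>DD. card (right_cosets_of G H D))"
    unfolding un using finDD[folded DD_def] disj by (intro card_UN_disjoint) auto
qed

text \<open>
  Both counts are sums over the finitely many double cosets in \<open>S\<close>, and the two summands at each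
  of them have ratio \<open>r\<close>.
\<close>

lemma card_cosets_ratio_Union:
  assumes "subgroup H G" "subgroup K G" "X \<subseteq> carrier G"
    and S: "S = (\<Union>x\<in>X. (H #> x) <#> K)"
    and fin: "finite (left_cosets_of G S K)" "finite (right_cosets_of G H S)"
    and com: "\<And>x. x \<in> X \<Longrightarrow> commensurable G H (conj_subgroup G x K)"
    and r: "\<And>x. x \<in> X \<Longrightarrow> relative_index G H (conj_subgroup G x K) = r"
  shows "real (card (left_cosets_of G S K)) = r * real (card (right_cosets_of G H S))"
  unfolding card_left_cosets_Union(2)[OF assms(1-5)]
    card_right_cosets_Union[OF assms(1-4) fin(2) card_left_cosets_Union(1)[OF assms(1-5)]]
    of_nat_sum sum_distrib_left
proof (rule sum.cong[OF refl])
  fix D assume "D \<in> (\<lambda>x. (H #> x) <#> K) ` X"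
  then obtain x where "x \<in> X" "D = (H #> x) <#> K" by blast
  then show "real (card (left_cosets_of G D K)) = r * real (card (right_cosets_of G H D))"
    using card_double_coset_ratio[OF assms(1,2), of x] com[of x] r[of x] assms(3) by (simp add: subset_iff)
qed

end

section \<open>Semidirect products\<close>

locale automorphism_action = V: group V + G: group G
  for V :: "('v, 'm) monoid_scheme" and G :: "('g, 'n) monoid_scheme" +
  fixes \<alpha> :: "'g \<Rightarrow> 'v \<Rightarrow> 'v"
  assumes action_hom: "\<alpha> \<in> hom G (AutoGroup V)"
begin

abbreviation VG :: "('v \<times> 'g) monoid" where "VG \<equiv> semidirect V G \<alpha>"

lemma action_automorphism:
  assumes "g \<in> carrier G"
  shows "\<alpha> g \<in> hom V V" "inj_on (\<alpha> g) (carrier V)" "\<alpha> g ` carrier V = carrier V"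
proof -
  have "\<alpha> g \<in> auto V"
    using action_hom assms by (auto simp: hom_def AutoGroup_def)
  then show "\<alpha> g \<in> hom V V" "inj_on (\<alpha> g) (carrier V)" "\<alpha> g ` carrier V = carrier V"
    by (auto simp: auto_def Bij_def bij_betw_def)
qed

lemma action_closed [simp, intro]: "g \<in> carrier G \<Longrightarrow> v \<in> carrier V \<Longrightarrow> \<alpha> g v \<in> carrier V"
  using action_automorphism(3) by blast

lemma action_mult [simp]:
  "g \<in> carrier G \<Longrightarrow> v \<in> carrier V \<Longrightarrow> w \<in> carrier V \<Longrightarrow> \<alpha> g (v \<otimes>\<^bsub>V\<^esub> w) = \<alpha> g v \<otimes>\<^bsub>V\<^esub> \<alpha> g w"
  using action_automorphism(1) by (rule hom_mult)

lemma action_group_hom: "g \<in> carrier G \<Longrightarrow> group_hom V V (\<alpha> g)"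
  using action_automorphism(1) by unfold_locales

lemma action_one [simp]: "g \<in> carrier G \<Longrightarrow> \<alpha> g \<one>\<^bsub>V\<^esub> = \<one>\<^bsub>V\<^esub>"
  using group_hom.hom_one[OF action_group_hom] .

lemma action_inv [simp]:
  "g \<in> carrier G \<Longrightarrow> v \<in> carrier V \<Longrightarrow> \<alpha> g (inv\<^bsub>V\<^esub> v) = inv\<^bsub>V\<^esub> (\<alpha> g v)"
  using group_hom.hom_inv[OF action_group_hom] .

lemma action_comp:
  assumes "g \<in> carrier G" "h \<in> carrier G" "v \<in> carrier V"
  shows "\<alpha> (g \<otimes>\<^bsub>G\<^esub> h) v = \<alpha> g (\<alpha> h v)"
proof -
  have "\<alpha> g \<in> Bij (carrier V)" "\<alpha> h \<in> Bij (carrier V)"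
    using action_hom assms by (auto simp: hom_def AutoGroup_def auto_def)
  then have "\<alpha> (g \<otimes>\<^bsub>G\<^esub> h) = compose (carrier V) (\<alpha> g) (\<alpha> h)"
    using hom_mult[OF action_hom assms(1,2)] by (simp add: AutoGroup_def BijGroup_def)
  then show ?thesis using assms by (simp add: compose_eq)
qed

lemma action_id [simp]:
  assumes "v \<in> carrier V" shows "\<alpha> \<one>\<^bsub>G\<^esub> v = v"
  using action_comp[of "\<one>\<^bsub>G\<^esub>" "\<one>\<^bsub>G\<^esub>" v] action_automorphism(2)[of "\<one>\<^bsub>G\<^esub>"] assms
  by (simp add: inj_on_eq_iff)

lemma action_cancel [simp]:
  assumes "g \<in> carrier G" "v \<in> carrier V"
  shows "\<alpha> g (\<alpha> (inv\<^bsub>G\<^esub> g) v) = v" "\<alpha> (inv\<^bsub>G\<^esub> g) (\<alpha> g v) = v"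
  using assms by (simp_all flip: action_comp)

lemma mem_action_image_iff:
  assumes "A \<subseteq> carrier V" "g \<in> carrier G" "v \<in> carrier V"
  shows "v \<in> \<alpha> g ` A \<longleftrightarrow> \<alpha> (inv\<^bsub>G\<^esub> g) v \<in> A"
  using assms by (auto simp: subset_iff intro!: image_eqI[of v _ "\<alpha> (inv\<^bsub>G\<^esub> g) v"])

lemma action_image_comp:
  assumes "A \<subseteq> carrier V" "g \<in> carrier G" "h \<in> carrier G"
  shows "\<alpha> (g \<otimes>\<^bsub>G\<^esub> h) ` A = \<alpha> g ` \<alpha> h ` A"
  unfolding image_image using assms by (intro image_cong) (auto simp: action_comp)

lemma action_image_id: "A \<subseteq> carrier V \<Longrightarrow> \<alpha> \<one>\<^bsub>G\<^esub> ` A = A"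
  by (force simp: subset_iff)

lemma action_image_subgroup: "subgroup A V \<Longrightarrow> g \<in> carrier G \<Longrightarrow> subgroup (\<alpha> g ` A) V"
  using group_hom.subgroup_img_is_subgroup[OF action_group_hom] .

lemma semidirect_simps [simp]:
  "carrier VG = carrier V \<times> carrier G"
  "\<one>\<^bsub>VG\<^esub> = (\<one>\<^bsub>V\<^esub>, \<one>\<^bsub>G\<^esub>)"
  "(v, g) \<otimes>\<^bsub>VG\<^esub> (w, h) = (v \<otimes>\<^bsub>V\<^esub> \<alpha> g w, g \<otimes>\<^bsub>G\<^esub> h)"
  by (simp_all add: semidirect_def)

lemma semidirect_group: "group VG"
proof (rule groupI)
  fix x assume "x \<in> carrier VG"
  then obtain v g where x: "x = (v, g)" "v \<in> carrier V" "g \<in> carrier G" by auto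
  then show "\<exists>y\<in>carrier VG. y \<otimes>\<^bsub>VG\<^esub> x = \<one>\<^bsub>VG\<^esub>"
    by (intro bexI[of _ "(\<alpha> (inv\<^bsub>G\<^esub> g) (inv\<^bsub>V\<^esub> v), inv\<^bsub>G\<^esub> g)"]) auto
qed (auto simp: V.m_assoc G.m_assoc action_comp)

sublocale VG: group VG
  by (rule semidirect_group)

lemma semidirect_inv [simp]:
  assumes "v \<in> carrier V" "g \<in> carrier G"
  shows "inv\<^bsub>VG\<^esub> (v, g) = (inv\<^bsub>V\<^esub> (\<alpha> (inv\<^bsub>G\<^esub> g) v), inv\<^bsub>G\<^esub> g)"
  by (rule VG.inv_equality) (use assms in auto)

lemma relative_index_action:
  assumes "subgroup A V" "subgroup B V" "g \<in> carrier G"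
  shows "relative_index V (\<alpha> g ` A) (\<alpha> g ` B) = relative_index V A B"
    "commensurable V (\<alpha> g ` A) (\<alpha> g ` B) \<longleftrightarrow> commensurable V A B"
  using V.relative_index_automorphism[OF action_automorphism(1,2) assms(1,2)] assms(3) by auto

lemma conj_subgroup_action:
  assumes "A \<subseteq> carrier V" "v \<in> carrier V" "g \<in> carrier G"
  shows "\<alpha> g ` conj_subgroup V v A = conj_subgroup V (\<alpha> g v) (\<alpha> g ` A)"
  unfolding V.conj_subgroup_image image_image using assms
  by (intro image_cong) (auto simp: subset_iff)

end

section \<open>Double cosets of the semidirect product\<close>

locale invariant_subgroups = automorphism_action V G \<alpha>
  for V :: "('v, 'm) monoid_scheme" and G :: "('g, 'n) monoid_scheme" and \<alpha> +
  fixes V0 :: "'v set" and \<Gamma> :: "'g set"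
  assumes V0: "subgroup V0 V" and \<Gamma>: "subgroup \<Gamma> G"
    and invariant: "\<And>\<gamma>. \<gamma> \<in> \<Gamma> \<Longrightarrow> \<alpha> \<gamma> ` V0 = V0"
begin

lemma V0_carrier: "V0 \<subseteq> carrier V" and \<Gamma>_carrier: "\<Gamma> \<subseteq> carrier G"
  using V0 \<Gamma> by (simp_all add: subgroup.subset)

lemma V0_mem [simp]: "a \<in> V0 \<Longrightarrow> a \<in> carrier V" and \<Gamma>_mem [simp]: "\<gamma> \<in> \<Gamma> \<Longrightarrow> \<gamma> \<in> carrier G"
  using V0_carrier \<Gamma>_carrier by auto

lemma invariant_mem_iff:
  assumes "\<gamma> \<in> \<Gamma>" "v \<in> carrier V"
  shows "\<alpha> \<gamma> v \<in> V0 \<longleftrightarrow> v \<in> V0"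
proof -
  have "inv\<^bsub>G\<^esub> \<gamma> \<in> \<Gamma>" using \<Gamma> assms by (simp add: subgroup.m_inv_closed)
  then have "\<alpha> (inv\<^bsub>G\<^esub> \<gamma>) ` V0 = V0" by (rule invariant)
  then show ?thesis using mem_action_image_iff[of V0 "inv\<^bsub>G\<^esub> \<gamma>" v] assms V0_carrier by simp
qed

lemma product_subgroup: "subgroup (V0 \<times> \<Gamma>) VG"
proof (rule VG.subgroupI)
  show "V0 \<times> \<Gamma> \<noteq> {}"
    using subgroup.one_closed[OF V0] subgroup.one_closed[OF \<Gamma>] by auto
  show "V0 \<times> \<Gamma> \<subseteq> carrier VG" by auto
next
  fix x assume "x \<in> V0 \<times> \<Gamma>"
  then obtain a \<gamma> where x: "x = (a, \<gamma>)" "a \<in> V0" "\<gamma> \<in> \<Gamma>" by auto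
  moreover have "inv\<^bsub>G\<^esub> \<gamma> \<in> \<Gamma>" using \<Gamma> x(3) by (rule subgroup.m_inv_closed)
  moreover have "inv\<^bsub>V\<^esub> a \<in> V0" using V0 x(2) by (rule subgroup.m_inv_closed)
  ultimately show "inv\<^bsub>VG\<^esub> x \<in> V0 \<times> \<Gamma>"
    using invariant_mem_iff[of "inv\<^bsub>G\<^esub> \<gamma>" "inv\<^bsub>V\<^esub> a"] by simp
next
  fix x y assume "x \<in> V0 \<times> \<Gamma>" "y \<in> V0 \<times> \<Gamma>"
  then obtain a \<gamma> b \<delta> where "x = (a, \<gamma>)" "y = (b, \<delta>)" "a \<in> V0" "\<gamma> \<in> \<Gamma>" "b \<in> V0" "\<delta> \<in> \<Gamma>" by auto
  then show "x \<otimes>\<^bsub>VG\<^esub> y \<in> V0 \<times> \<Gamma>"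
    using V0 \<Gamma> by (simp add: subgroup.m_closed invariant_mem_iff)
qed

text \<open>
  The stabilizer in \<open>\<Gamma>\<close> of the coset \<open>g \<Gamma>\<close>.
\<close>

definition coset_stabilizer :: "'g \<Rightarrow> 'g set" where "coset_stabilizer g = conj_subgroup G g \<Gamma> \<inter> \<Gamma>"

lemma coset_stabilizer_mem: "\<delta> \<in> coset_stabilizer g \<Longrightarrow> \<delta> \<in> \<Gamma>"
  by (simp add: coset_stabilizer_def)

text \<open>
  These are the \<open>x \<in> V\<close> for which \<open>(x, g)\<close> lies in the double coset of \<open>(v, g)\<close>.
\<close>

definition orbit_double_coset :: "'v \<Rightarrow> 'g \<Rightarrow> 'v set" where
  "orbit_double_coset v g = V0 <#>\<^bsub>V\<^esub> subgroup_orbit G (coset_stabilizer g) \<alpha> v <#>\<^bsub>V\<^esub> \<alpha> g ` V0"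

lemma coset_stabilizer_subgroup: "g \<in> carrier G \<Longrightarrow> subgroup (coset_stabilizer g) G"
  using G.conj_subgroup_is_subgroup[OF \<Gamma>] \<Gamma> G.subgroups_Inter_pair unfolding coset_stabilizer_def by blast

lemma mem_coset_stabilizer_iff:
  "g \<in> carrier G \<Longrightarrow> \<delta> \<in> coset_stabilizer g \<longleftrightarrow> \<delta> \<in> \<Gamma> \<and> inv\<^bsub>G\<^esub> g \<otimes>\<^bsub>G\<^esub> \<delta> \<otimes>\<^bsub>G\<^esub> g \<in> \<Gamma>"
  using G.mem_conj_subgroup_iff[OF \<Gamma>_carrier] by (auto simp: coset_stabilizer_def)

lemma orbit_eq: "subgroup_orbit G H \<alpha> v = (\<lambda>\<delta>. \<alpha> \<delta> v) ` H"
  by (auto simp: subgroup_orbit_def orbit_def)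

lemma orbit_carrier: "v \<in> carrier V \<Longrightarrow> subgroup_orbit G (coset_stabilizer g) \<alpha> v \<subseteq> carrier V"
  by (auto simp: orbit_eq dest: coset_stabilizer_mem)

lemma left_cosets_orbit_double_coset:
  assumes "v \<in> carrier V" "g \<in> carrier G"
  shows "left_cosets_of V (orbit_double_coset v g) (\<alpha> g ` V0)
    = (\<lambda>(a, \<delta>). (a \<otimes>\<^bsub>V\<^esub> \<alpha> \<delta> v) <#\<^bsub>V\<^esub> \<alpha> g ` V0) ` (V0 \<times> coset_stabilizer g)"
proof -
  have "left_cosets_of V (orbit_double_coset v g) (\<alpha> g ` V0)
      = left_cosets_of V (V0 <#>\<^bsub>V\<^esub> subgroup_orbit G (coset_stabilizer g) \<alpha> v) (\<alpha> g ` V0)"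
    unfolding orbit_double_coset_def
    by (rule V.left_cosets_of_set_mult[OF action_image_subgroup[OF V0 assms(2)]
          V.set_mult_closed[OF V0_carrier orbit_carrier[OF assms(1)]]])
  also have "V0 <#>\<^bsub>V\<^esub> subgroup_orbit G (coset_stabilizer g) \<alpha> v = (\<lambda>(a, \<delta>). a \<otimes>\<^bsub>V\<^esub> \<alpha> \<delta> v) ` (V0 \<times> coset_stabilizer g)"
    by (auto simp: orbit_eq set_mult_def image_iff)
  finally show ?thesis
    by (simp add: left_cosets_of_def image_image case_prod_unfold)
qed

lemma semidirect_coset_eq_iff:
  assumes "w \<in> carrier V" "h \<in> carrier G" "w' \<in> carrier V" "h' \<in> carrier G"
  shows "(w, h) <#\<^bsub>VG\<^esub> (V0 \<times> \<Gamma>) = (w', h') <#\<^bsub>VG\<^esub> (V0 \<times> \<Gamma>) \<longleftrightarrow>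
    inv\<^bsub>V\<^esub> w \<otimes>\<^bsub>V\<^esub> w' \<in> \<alpha> h ` V0 \<and> inv\<^bsub>G\<^esub> h \<otimes>\<^bsub>G\<^esub> h' \<in> \<Gamma>"
  using VG.l_coset_eq_iff[OF product_subgroup, of "(w,h)" "(w',h')"] assms
    mem_action_image_iff[OF V0_carrier, of h "inv\<^bsub>V\<^esub> w \<otimes>\<^bsub>V\<^esub> w'"]
  by simp

text \<open>
  Left cosets of \<open>V0 \<times> \<Gamma>\<close> in the double coset of \<open>(v, g)\<close> have the form
  \<open>(b \<gamma>(v), \<gamma> g) (V0 \<times> \<Gamma>)\<close> with \<open>b \<in> V0\<close> and \<open>\<gamma> \<in> \<Gamma>\<close>. The second
  component gives a left coset of \<open>\<Gamma>\<close> in \<open>\<Gamma> g \<Gamma>\<close>. All fibres of this projection look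
  alike: over \<open>g \<Gamma>\<close> one has \<open>\<gamma> \<in> \<Gamma> \<inter> g \<Gamma> g\<^sup>-\<^sup>1\<close>, and then
  \<open>\<gamma> g (V0) = g (V0)\<close>, so the first component is determined modulo \<open>g (V0)\<close>. Moving
  the other fibres to this one requires a transversal \<open>T\<close> of \<open>\<Gamma> / (\<Gamma> \<inter> g \<Gamma> g\<^sup>-\<^sup>1)\<close>.
\<close>

lemma left_cosets_semidirect:
  assumes v: "v \<in> carrier V" and g: "g \<in> carrier G"
  shows "left_cosets_of VG (V0 \<times> \<Gamma>) ((V0 \<times> \<Gamma>) \<inter> conj_subgroup VG (v, g) (V0 \<times> \<Gamma>))
    \<approx> left_cosets_of G \<Gamma> (\<Gamma> \<inter> conj_subgroup G g \<Gamma>)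
      \<times> left_cosets_of V (orbit_double_coset v g) (\<alpha> g ` V0)"
proof -
  note sub = coset_stabilizer_subgroup[OF g]
  obtain T where T: "T \<subseteq> \<Gamma>" "inj_on (\<lambda>t. t <#\<^bsub>G\<^esub> coset_stabilizer g) T"
      "(\<lambda>t. t <#\<^bsub>G\<^esub> coset_stabilizer g) ` T = (\<lambda>t. t <#\<^bsub>G\<^esub> coset_stabilizer g) ` \<Gamma>"
    by (rule transversal_exists)
  \<comment> \<open>The triple \<open>(t, a, \<delta>)\<close> stands for the element \<open>(1, t) (a, \<delta>)\<close> of \<open>V0 \<times> \<Gamma>\<close>.\<close>
  define P where "P = T \<times> V0 \<times> coset_stabilizer g"
  define F where "F = (\<lambda>(t, a, \<delta>). (\<alpha> t (a \<otimes>\<^bsub>V\<^esub> \<alpha> \<delta> v), t \<otimes>\<^bsub>G\<^esub> g) <#\<^bsub>VG\<^esub> (V0 \<times> \<Gamma>))"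
  define F' where "F' = (\<lambda>(t, a, \<delta>). (t <#\<^bsub>G\<^esub> coset_stabilizer g, (a \<otimes>\<^bsub>V\<^esub> \<alpha> \<delta> v) <#\<^bsub>V\<^esub> \<alpha> g ` V0))"
  have "left_cosets_of VG (V0 \<times> \<Gamma>) ((V0 \<times> \<Gamma>) \<inter> conj_subgroup VG (v, g) (V0 \<times> \<Gamma>))
      \<approx> left_cosets_of VG (((V0 \<times> \<Gamma>) #>\<^bsub>VG\<^esub> (v, g)) <#>\<^bsub>VG\<^esub> (V0 \<times> \<Gamma>)) (V0 \<times> \<Gamma>)"
    using assms by (intro VG.left_cosets_of_double_coset product_subgroup) auto
  also have "\<dots> = left_cosets_of VG ((V0 \<times> \<Gamma>) #>\<^bsub>VG\<^esub> (v, g)) (V0 \<times> \<Gamma>)"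
    using assms by (intro VG.left_cosets_of_set_mult product_subgroup)
      (auto simp: r_coset_def)
  also have "\<dots> = (\<lambda>(b, \<gamma>). (b \<otimes>\<^bsub>V\<^esub> \<alpha> \<gamma> v, \<gamma> \<otimes>\<^bsub>G\<^esub> g) <#\<^bsub>VG\<^esub> (V0 \<times> \<Gamma>)) ` (V0 \<times> \<Gamma>)"
    unfolding left_cosets_of_def r_coset_def by force
  also have "\<dots> = F ` P"
  proof (intro equalityI subsetI)
    fix C assume "C \<in> (\<lambda>(b, \<gamma>). (b \<otimes>\<^bsub>V\<^esub> \<alpha> \<gamma> v, \<gamma> \<otimes>\<^bsub>G\<^esub> g) <#\<^bsub>VG\<^esub> (V0 \<times> \<Gamma>)) ` (V0 \<times> \<Gamma>)"
    then obtain b \<gamma> where b: "b \<in> V0" and \<gamma>: "\<gamma> \<in> \<Gamma>"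
      and C: "C = (b \<otimes>\<^bsub>V\<^esub> \<alpha> \<gamma> v, \<gamma> \<otimes>\<^bsub>G\<^esub> g) <#\<^bsub>VG\<^esub> (V0 \<times> \<Gamma>)" by auto
    have "\<gamma> <#\<^bsub>G\<^esub> coset_stabilizer g \<in> (\<lambda>t. t <#\<^bsub>G\<^esub> coset_stabilizer g) ` T" unfolding T(3) using \<gamma> by simp
    then obtain t where t: "t \<in> T" "t <#\<^bsub>G\<^esub> coset_stabilizer g = \<gamma> <#\<^bsub>G\<^esub> coset_stabilizer g" by force
    have t\<Gamma>: "t \<in> \<Gamma>" using t T(1) by auto
    \<comment> \<open>Replacing \<open>\<gamma> = t \<delta>\<close> by \<open>t\<close> in the second component does not change the coset.\<close>
    define \<delta> where "\<delta> = inv\<^bsub>G\<^esub> t \<otimes>\<^bsub>G\<^esub> \<gamma>"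
    have \<delta>: "\<delta> \<in> coset_stabilizer g" using t(2) G.l_coset_eq_iff[OF sub, of t \<gamma>] t\<Gamma> \<gamma> by (simp add: \<delta>_def)
    have \<delta>\<Gamma>: "\<delta> \<in> \<Gamma>" using \<delta> by (rule coset_stabilizer_mem)
    have \<gamma>_eq: "\<gamma> = t \<otimes>\<^bsub>G\<^esub> \<delta>" using t\<Gamma> \<gamma> by (simp add: \<delta>_def flip: G.m_assoc)
    define a where "a = \<alpha> (inv\<^bsub>G\<^esub> t) b"
    have a: "a \<in> V0" unfolding a_def
      using b t\<Gamma> invariant_mem_iff[of "inv\<^bsub>G\<^esub> t" b] \<Gamma> by (simp add: subgroup.m_inv_closed)
    have "\<alpha> t (a \<otimes>\<^bsub>V\<^esub> \<alpha> \<delta> v) = b \<otimes>\<^bsub>V\<^esub> \<alpha> \<gamma> v"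
      using a b t\<Gamma> \<delta>\<Gamma> v by (simp add: \<gamma>_eq action_comp) (simp add: a_def)
    moreover have "inv\<^bsub>G\<^esub> (\<gamma> \<otimes>\<^bsub>G\<^esub> g) \<otimes>\<^bsub>G\<^esub> (t \<otimes>\<^bsub>G\<^esub> g) \<in> \<Gamma>"
    proof -
      have "inv\<^bsub>G\<^esub> \<delta> \<in> coset_stabilizer g" using \<delta> sub by (rule subgroup.m_inv_closed[rotated])
      moreover have "inv\<^bsub>G\<^esub> (\<gamma> \<otimes>\<^bsub>G\<^esub> g) \<otimes>\<^bsub>G\<^esub> (t \<otimes>\<^bsub>G\<^esub> g) = inv\<^bsub>G\<^esub> g \<otimes>\<^bsub>G\<^esub> inv\<^bsub>G\<^esub> \<delta> \<otimes>\<^bsub>G\<^esub> g"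
        using t\<Gamma> \<delta>\<Gamma> g by (simp add: \<gamma>_eq G.inv_mult_group G.m_assoc) (simp flip: G.m_assoc)
      ultimately show ?thesis using g by (simp add: mem_coset_stabilizer_iff)
    qed
    moreover have "\<one>\<^bsub>V\<^esub> \<in> \<alpha> (\<gamma> \<otimes>\<^bsub>G\<^esub> g) ` V0"
      using g \<gamma> V0 by (intro subgroup.one_closed action_image_subgroup) simp_all
    ultimately have "C = F (t, a, \<delta>)"
      unfolding C F_def using b \<gamma> t\<Gamma> v g by (simp add: semidirect_coset_eq_iff)
    then show "C \<in> F ` P" using t(1) a \<delta> by (auto simp: P_def)
  next
    fix C assume "C \<in> F ` P"
    then obtain t a \<delta> where t: "t \<in> \<Gamma>" "a \<in> V0" "\<delta> \<in> coset_stabilizer g" and C: "C = F (t, a, \<delta>)"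
      using T(1) by (auto simp: P_def)
    have \<delta>: "\<delta> \<in> \<Gamma>" using t(3) by (rule coset_stabilizer_mem)
    have "C = (\<alpha> t a \<otimes>\<^bsub>V\<^esub> \<alpha> (t \<otimes>\<^bsub>G\<^esub> \<delta>) v, (t \<otimes>\<^bsub>G\<^esub> \<delta>) \<otimes>\<^bsub>G\<^esub> g) <#\<^bsub>VG\<^esub> (V0 \<times> \<Gamma>)"
    proof -
      have "inv\<^bsub>G\<^esub> (t \<otimes>\<^bsub>G\<^esub> g) \<otimes>\<^bsub>G\<^esub> ((t \<otimes>\<^bsub>G\<^esub> \<delta>) \<otimes>\<^bsub>G\<^esub> g) = inv\<^bsub>G\<^esub> g \<otimes>\<^bsub>G\<^esub> \<delta> \<otimes>\<^bsub>G\<^esub> g"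
        using t \<delta> g by (simp add: G.inv_mult_group G.m_assoc) (simp flip: G.m_assoc)
      moreover have "\<one>\<^bsub>V\<^esub> \<in> \<alpha> (t \<otimes>\<^bsub>G\<^esub> g) ` V0"
        using g t V0 by (intro subgroup.one_closed action_image_subgroup) simp_all
      ultimately show ?thesis
        unfolding C F_def using t \<delta> v g by (simp add: semidirect_coset_eq_iff action_comp mem_coset_stabilizer_iff)
    qed
    moreover have "\<alpha> t a \<in> V0" "t \<otimes>\<^bsub>G\<^esub> \<delta> \<in> \<Gamma>"
      using t \<delta> \<Gamma> by (simp_all add: invariant_mem_iff subgroup.m_closed)
    ultimately show "C \<in> (\<lambda>(b, \<gamma>). (b \<otimes>\<^bsub>V\<^esub> \<alpha> \<gamma> v, \<gamma> \<otimes>\<^bsub>G\<^esub> g) <#\<^bsub>VG\<^esub> (V0 \<times> \<Gamma>)) ` (V0 \<times> \<Gamma>)"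
      by (intro image_eqI[of _ _ "(\<alpha> t a, t \<otimes>\<^bsub>G\<^esub> \<delta>)"]) simp_all
  qed
  also have "F ` P \<approx> F' ` P"
  proof (rule eqpoll_same_kernel)
    fix p q assume "p \<in> P" "q \<in> P"
    then obtain t a \<delta> t' a' \<delta>' where p: "p = (t, a, \<delta>)" "q = (t', a', \<delta>')"
      and T': "t \<in> T" "t' \<in> T" and a: "a \<in> V0" "a' \<in> V0"
      and \<delta>: "\<delta> \<in> coset_stabilizer g" "\<delta>' \<in> coset_stabilizer g"
      by (auto simp: P_def)
    note h = a \<delta>[THEN coset_stabilizer_mem]
    have t: "t \<in> \<Gamma>" "t' \<in> \<Gamma>" using T' T(1) by auto
    define x where "x = a \<otimes>\<^bsub>V\<^esub> \<alpha> \<delta> v"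
    define y where "y = a' \<otimes>\<^bsub>V\<^esub> \<alpha> \<delta>' v"
    have xy: "x \<in> carrier V" "y \<in> carrier V" using h v by (simp_all add: x_def y_def)
    have Feq: "F p = F q \<longleftrightarrow> inv\<^bsub>V\<^esub> (\<alpha> t x) \<otimes>\<^bsub>V\<^esub> \<alpha> t' y \<in> \<alpha> (t \<otimes>\<^bsub>G\<^esub> g) ` V0
        \<and> inv\<^bsub>G\<^esub> (t \<otimes>\<^bsub>G\<^esub> g) \<otimes>\<^bsub>G\<^esub> (t' \<otimes>\<^bsub>G\<^esub> g) \<in> \<Gamma>"
      unfolding p F_def using xy t g by (simp add: semidirect_coset_eq_iff flip: x_def y_def)
    have F'eq: "F' p = F' q \<longleftrightarrow> t <#\<^bsub>G\<^esub> coset_stabilizer g = t' <#\<^bsub>G\<^esub> coset_stabilizer g \<and> inv\<^bsub>V\<^esub> x \<otimes>\<^bsub>V\<^esub> y \<in> \<alpha> g ` V0"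
      unfolding p F'_def
      using V.l_coset_eq_iff[OF action_image_subgroup[OF V0 g] xy] by (simp flip: x_def y_def)
    have "inv\<^bsub>G\<^esub> (t \<otimes>\<^bsub>G\<^esub> g) \<otimes>\<^bsub>G\<^esub> (t' \<otimes>\<^bsub>G\<^esub> g) \<in> \<Gamma> \<longleftrightarrow> inv\<^bsub>G\<^esub> t \<otimes>\<^bsub>G\<^esub> t' \<in> coset_stabilizer g"
    proof -
      have "inv\<^bsub>G\<^esub> t \<otimes>\<^bsub>G\<^esub> t' \<in> \<Gamma>" using t \<Gamma> by (simp add: subgroup.m_closed subgroup.m_inv_closed)
      then show ?thesis using t g by (simp add: mem_coset_stabilizer_iff G.inv_mult_group G.m_assoc)
    qed
    also have "\<dots> \<longleftrightarrow> t <#\<^bsub>G\<^esub> coset_stabilizer g = t' <#\<^bsub>G\<^esub> coset_stabilizer g"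
      using G.l_coset_eq_iff[OF sub, of t t'] t by simp
    finally have second: "inv\<^bsub>G\<^esub> (t \<otimes>\<^bsub>G\<^esub> g) \<otimes>\<^bsub>G\<^esub> (t' \<otimes>\<^bsub>G\<^esub> g) \<in> \<Gamma> \<longleftrightarrow> t <#\<^bsub>G\<^esub> coset_stabilizer g = t' <#\<^bsub>G\<^esub> coset_stabilizer g" .
    have first: "inv\<^bsub>V\<^esub> (\<alpha> t x) \<otimes>\<^bsub>V\<^esub> \<alpha> t' y \<in> \<alpha> (t \<otimes>\<^bsub>G\<^esub> g) ` V0 \<longleftrightarrow> inv\<^bsub>V\<^esub> x \<otimes>\<^bsub>V\<^esub> y \<in> \<alpha> g ` V0"
      if "t <#\<^bsub>G\<^esub> coset_stabilizer g = t' <#\<^bsub>G\<^esub> coset_stabilizer g"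
    proof -
      have tt: "t' = t" using that T(2) T' by (simp add: inj_on_def)
      have "inv\<^bsub>V\<^esub> (\<alpha> t x) \<otimes>\<^bsub>V\<^esub> \<alpha> t y = \<alpha> t (inv\<^bsub>V\<^esub> x \<otimes>\<^bsub>V\<^esub> y)" using t xy by simp
      moreover have "\<alpha> (t \<otimes>\<^bsub>G\<^esub> g) ` V0 = \<alpha> t ` \<alpha> g ` V0"
        using t g V0_carrier by (simp add: action_image_comp)
      moreover have "\<alpha> g ` V0 \<subseteq> carrier V" using g by auto
      ultimately show ?thesis
        unfolding tt using inj_on_image_mem_iff[OF action_automorphism(2)[of t], of "inv\<^bsub>V\<^esub> x \<otimes>\<^bsub>V\<^esub> y" "\<alpha> g ` V0"] t xy
        by simp
    qed
    show "F p = F q \<longleftrightarrow> F' p = F' q" unfolding Feq F'eq second using first by blast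
  qed
  also have "F' ` P = left_cosets_of G \<Gamma> (coset_stabilizer g) \<times> left_cosets_of V (orbit_double_coset v g) (\<alpha> g ` V0)"
    unfolding left_cosets_orbit_double_coset[OF v g] left_cosets_of_def[of G] T(3)[symmetric] P_def F'_def
    by force
  finally show ?thesis by (simp add: coset_stabilizer_def Int_commute)
qed

lemma hecke_L_semidirect:
  assumes "v \<in> carrier V" "g \<in> carrier G"
  shows "hecke_L VG (V0 \<times> \<Gamma>) (v, g)
    = hecke_L G \<Gamma> g * card (left_cosets_of V (orbit_double_coset v g) (\<alpha> g ` V0))"
  using eqpoll_card_eq[OF left_cosets_semidirect[OF assms]]
  by (simp add: hecke_L_def sub_index_def card_cartesian_product)

lemma left_cosets_orbit_double_coset_nonempty:
  assumes "v \<in> carrier V" "g \<in> carrier G"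
  shows "left_cosets_of V (orbit_double_coset v g) (\<alpha> g ` V0) \<noteq> {}"
  using subgroup.one_closed[OF V0] subgroup.one_closed[OF coset_stabilizer_subgroup[OF assms(2)]]
  by (auto simp: left_cosets_orbit_double_coset[OF assms])

lemma finite_index_semidirect_iff:
  assumes "v \<in> carrier V" "g \<in> carrier G"
  shows "finite_index VG (V0 \<times> \<Gamma>) ((V0 \<times> \<Gamma>) \<inter> conj_subgroup VG (v, g) (V0 \<times> \<Gamma>)) \<longleftrightarrow>
    finite_index G \<Gamma> (\<Gamma> \<inter> conj_subgroup G g \<Gamma>) \<and>
    finite (left_cosets_of V (orbit_double_coset v g) (\<alpha> g ` V0))"
proof -
  have "left_cosets_of G \<Gamma> (\<Gamma> \<inter> conj_subgroup G g \<Gamma>) \<noteq> {}"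
    using subgroup.one_closed[OF \<Gamma>] by (auto simp: left_cosets_of_def)
  then show ?thesis
    using eqpoll_finite_iff[OF left_cosets_semidirect[OF assms]]
      left_cosets_orbit_double_coset_nonempty[OF assms]
    by (auto simp: finite_index_def finite_cartesian_product_iff)
qed

text \<open>
  The product decomposition separates the Hecke condition into a condition on \<open>G\<close> and one on
  \<open>V\<close>.
\<close>

lemma hecke_pair_semidirect_iff:
  "hecke_pair VG (V0 \<times> \<Gamma>) \<longleftrightarrow> hecke_pair G \<Gamma> \<and>
    (\<forall>v\<in>carrier V. \<forall>g\<in>carrier G. finite (left_cosets_of V (orbit_double_coset v g) (\<alpha> g ` V0)))"
  using V.one_closed semidirect_group product_subgroup G.is_group \<Gamma>
  by (auto simp: hecke_pair_def finite_index_semidirect_iff)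

lemma orbit_double_coset_eq_image:
  "orbit_double_coset v g
    = (\<lambda>(a, \<delta>, b). a \<otimes>\<^bsub>V\<^esub> \<alpha> \<delta> v \<otimes>\<^bsub>V\<^esub> \<alpha> g b) ` (V0 \<times> coset_stabilizer g \<times> V0)"
  by (force simp: orbit_double_coset_def orbit_eq set_mult_def)

lemma orbit_double_coset_eq_Union:
  "orbit_double_coset v g
    = (\<Union>w\<in>subgroup_orbit G (coset_stabilizer g) \<alpha> v. (V0 #>\<^bsub>V\<^esub> w) <#>\<^bsub>V\<^esub> \<alpha> g ` V0)"
  by (force simp: orbit_double_coset_def set_mult_def r_coset_def)

lemma orbit_double_coset_carrier:
  assumes "v \<in> carrier V" "g \<in> carrier G"
  shows "orbit_double_coset v g \<subseteq> carrier V"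
  using assms by (auto simp: orbit_double_coset_eq_image dest: coset_stabilizer_mem)

lemma coset_stabilizer_inv:
  assumes "g \<in> carrier G" "\<delta> \<in> coset_stabilizer g"
  shows "inv\<^bsub>G\<^esub> g \<otimes>\<^bsub>G\<^esub> \<delta> \<otimes>\<^bsub>G\<^esub> g \<in> coset_stabilizer (inv\<^bsub>G\<^esub> g)"
proof -
  have \<delta>: "\<delta> \<in> \<Gamma>" "inv\<^bsub>G\<^esub> g \<otimes>\<^bsub>G\<^esub> \<delta> \<otimes>\<^bsub>G\<^esub> g \<in> \<Gamma>"
    using assms mem_coset_stabilizer_iff by blast+
  moreover have "g \<otimes>\<^bsub>G\<^esub> (inv\<^bsub>G\<^esub> g \<otimes>\<^bsub>G\<^esub> \<delta> \<otimes>\<^bsub>G\<^esub> g) \<otimes>\<^bsub>G\<^esub> inv\<^bsub>G\<^esub> g = \<delta>"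
    using \<delta>(1) assms(1) by (simp add: G.m_assoc) (simp flip: G.m_assoc)
  ultimately show ?thesis using assms(1) by (simp add: mem_coset_stabilizer_iff)
qed

lemma inv_mem_orbit_double_coset:
  assumes v: "v \<in> carrier V" and g: "g \<in> carrier G" and s: "s \<in> orbit_double_coset v g"
  shows "\<alpha> (inv\<^bsub>G\<^esub> g) (inv\<^bsub>V\<^esub> s)
    \<in> orbit_double_coset (\<alpha> (inv\<^bsub>G\<^esub> g) (inv\<^bsub>V\<^esub> v)) (inv\<^bsub>G\<^esub> g)"
proof -
  obtain a \<delta> b where ab: "a \<in> V0" "b \<in> V0" and \<delta>: "\<delta> \<in> coset_stabilizer g"
    and s_eq: "s = a \<otimes>\<^bsub>V\<^esub> \<alpha> \<delta> v \<otimes>\<^bsub>V\<^esub> \<alpha> g b"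
    using s by (auto simp: orbit_double_coset_eq_image)
  have \<delta>\<Gamma>: "\<delta> \<in> \<Gamma>" using \<delta> by (rule coset_stabilizer_mem)
  define \<epsilon> where "\<epsilon> = inv\<^bsub>G\<^esub> g \<otimes>\<^bsub>G\<^esub> \<delta> \<otimes>\<^bsub>G\<^esub> g"
  have \<epsilon>: "\<epsilon> \<in> coset_stabilizer (inv\<^bsub>G\<^esub> g)" unfolding \<epsilon>_def using g \<delta> by (rule coset_stabilizer_inv)
  have "\<alpha> \<epsilon> (\<alpha> (inv\<^bsub>G\<^esub> g) (inv\<^bsub>V\<^esub> v)) = \<alpha> (inv\<^bsub>G\<^esub> g) (\<alpha> \<delta> (inv\<^bsub>V\<^esub> v))"
    unfolding \<epsilon>_def using g v \<delta>\<Gamma> by (simp add: action_comp)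
  then have "\<alpha> (inv\<^bsub>G\<^esub> g) (inv\<^bsub>V\<^esub> s)
      = inv\<^bsub>V\<^esub> b \<otimes>\<^bsub>V\<^esub> \<alpha> \<epsilon> (\<alpha> (inv\<^bsub>G\<^esub> g) (inv\<^bsub>V\<^esub> v)) \<otimes>\<^bsub>V\<^esub> \<alpha> (inv\<^bsub>G\<^esub> g) (inv\<^bsub>V\<^esub> a)"
    using ab v g \<delta>\<Gamma> by (simp add: s_eq V.inv_mult_group V.m_assoc)
  moreover have "inv\<^bsub>V\<^esub> a \<in> V0" "inv\<^bsub>V\<^esub> b \<in> V0"
    using ab V0 by (simp_all add: subgroup.m_inv_closed)
  ultimately show ?thesis
    unfolding orbit_double_coset_eq_image using \<epsilon> by force
qed

text \<open>
  The map \<open>s \<mapsto> g\<^sup>-\<^sup>1(s\<^sup>-\<^sup>1)\<close> carries the set attached to \<open>(v, g)\<close> to the one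
  attached to its inverse in the semidirect product. It conjugates \<open>\<Gamma> \<inter> g \<Gamma> g\<^sup>-\<^sup>1\<close> into
  \<open>\<Gamma> \<inter> g\<^sup>-\<^sup>1 \<Gamma> g\<close>. This reduces the count of right cosets to that of left cosets.
\<close>

lemma inv_orbit_double_coset:
  assumes v: "v \<in> carrier V" and g: "g \<in> carrier G"
  shows "\<alpha> (inv\<^bsub>G\<^esub> g) ` m_inv V ` orbit_double_coset v g
    = orbit_double_coset (\<alpha> (inv\<^bsub>G\<^esub> g) (inv\<^bsub>V\<^esub> v)) (inv\<^bsub>G\<^esub> g)"
proof (intro equalityI subsetI)
  \<comment> \<open>The map is inverted by the corresponding map for \<open>(v, g)\<^sup>-\<^sup>1\<close>.\<close>
  fix s assume s: "s \<in> orbit_double_coset (\<alpha> (inv\<^bsub>G\<^esub> g) (inv\<^bsub>V\<^esub> v)) (inv\<^bsub>G\<^esub> g)"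
  have sc: "s \<in> carrier V" using s orbit_double_coset_carrier g v by (meson G.inv_closed V.inv_closed action_closed subsetD)
  have "\<alpha> g (inv\<^bsub>V\<^esub> s) \<in> orbit_double_coset v g"
    using inv_mem_orbit_double_coset[OF _ _ s] v g by simp
  then show "s \<in> \<alpha> (inv\<^bsub>G\<^esub> g) ` m_inv V ` orbit_double_coset v g"
    unfolding image_image by (rule rev_image_eqI) (use g sc in simp)
qed (use inv_mem_orbit_double_coset v g in blast)

lemma right_cosets_orbit_double_coset:
  assumes v: "v \<in> carrier V" and g: "g \<in> carrier G"
  shows "right_cosets_of V V0 (orbit_double_coset v g)
    \<approx> left_cosets_of V (orbit_double_coset (\<alpha> (inv\<^bsub>G\<^esub> g) (inv\<^bsub>V\<^esub> v)) (inv\<^bsub>G\<^esub> g))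
        (\<alpha> (inv\<^bsub>G\<^esub> g) ` V0)"
proof -
  have "right_cosets_of V V0 (orbit_double_coset v g)
      \<approx> left_cosets_of V (m_inv V ` orbit_double_coset v g) V0"
    using V0 orbit_double_coset_carrier[OF assms] by (rule V.right_cosets_eqpoll_left_cosets)
  also have "\<dots> \<approx> left_cosets_of V (\<alpha> (inv\<^bsub>G\<^esub> g) ` m_inv V ` orbit_double_coset v g) (\<alpha> (inv\<^bsub>G\<^esub> g) ` V0)"
    using orbit_double_coset_carrier[OF assms] g
    by (intro eqpoll_sym[OF V.left_cosets_of_automorphism[OF action_automorphism(1,2) V0]]) auto
  finally show ?thesis unfolding inv_orbit_double_coset[OF assms] .
qed

lemma hecke_R_semidirect:
  assumes "v \<in> carrier V" "g \<in> carrier G"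
  shows "hecke_R VG (V0 \<times> \<Gamma>) (v, g)
    = hecke_R G \<Gamma> g * card (right_cosets_of V V0 (orbit_double_coset v g))"
  using hecke_L_semidirect[of "\<alpha> (inv\<^bsub>G\<^esub> g) (inv\<^bsub>V\<^esub> v)" "inv\<^bsub>G\<^esub> g"]
    eqpoll_card_eq[OF right_cosets_orbit_double_coset[OF assms]] assms
  by (simp add: hecke_R_def)

lemma coset_stabilizer_one: "coset_stabilizer \<one>\<^bsub>G\<^esub> = \<Gamma>"
  by (simp add: coset_stabilizer_def G.conj_subgroup_one[OF \<Gamma>_carrier])

section \<open>The Hecke condition\<close>

lemma finite_index_of_orbit_double_coset:
  assumes "v \<in> carrier V" "g \<in> carrier G"
    and fin: "finite (left_cosets_of V (orbit_double_coset v g) (\<alpha> g ` V0))"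
  shows "finite_index V V0 (V0 \<inter> conj_subgroup V v (\<alpha> g ` V0))"
proof -
  have "v \<in> subgroup_orbit G (coset_stabilizer g) \<alpha> v"
    using subgroup.one_closed[OF coset_stabilizer_subgroup[OF assms(2)]] assms(1)
    by (auto simp: orbit_eq intro!: image_eqI[of _ _ "\<one>\<^bsub>G\<^esub>"])
  then have "(V0 #>\<^bsub>V\<^esub> v) <#>\<^bsub>V\<^esub> \<alpha> g ` V0 \<subseteq> orbit_double_coset v g"
    unfolding orbit_double_coset_eq_Union by blast
  then have "finite (left_cosets_of V ((V0 #>\<^bsub>V\<^esub> v) <#>\<^bsub>V\<^esub> \<alpha> g ` V0) (\<alpha> g ` V0))"
    using fin unfolding left_cosets_of_def by (meson finite_subset image_mono)
  then show ?thesis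
    using eqpoll_finite_iff[OF V.left_cosets_of_double_coset[OF V0 action_image_subgroup[OF V0 assms(2)] assms(1)]]
    by (simp add: finite_index_def)
qed

lemma action_double_coset:
  assumes "\<gamma> \<in> \<Gamma>" "v \<in> carrier V"
  shows "\<alpha> \<gamma> ` double_coset V V0 v = double_coset V V0 (\<alpha> \<gamma> v)"
proof -
  have "\<alpha> \<gamma> ` double_coset V V0 v = (\<lambda>(a, b). \<alpha> \<gamma> a \<otimes>\<^bsub>V\<^esub> \<alpha> \<gamma> v \<otimes>\<^bsub>V\<^esub> \<alpha> \<gamma> b) ` (V0 \<times> V0)"
    unfolding double_coset_def V.double_coset_eq_image image_image
    using assms by (intro image_cong) auto
  also have "\<dots> = (\<lambda>(a, b). a \<otimes>\<^bsub>V\<^esub> \<alpha> \<gamma> v \<otimes>\<^bsub>V\<^esub> b) ` (\<alpha> \<gamma> ` V0 \<times> \<alpha> \<gamma> ` V0)"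
    by force
  finally show ?thesis
    unfolding invariant[OF assms(1)] double_coset_def V.double_coset_eq_image .
qed

lemma orbit_of_double_coset:
  assumes "v \<in> carrier V"
  shows "subgroup_orbit G \<Gamma> (\<lambda>\<gamma> S. \<alpha> \<gamma> ` S) (double_coset V V0 v)
    = double_coset V V0 ` subgroup_orbit G \<Gamma> \<alpha> v"
proof -
  have "subgroup_orbit G \<Gamma> (\<lambda>\<gamma> S. \<alpha> \<gamma> ` S) (double_coset V V0 v) = (\<lambda>\<gamma>. \<alpha> \<gamma> ` double_coset V V0 v) ` \<Gamma>"
    by (auto simp: subgroup_orbit_def orbit_def)
  then show ?thesis
    unfolding orbit_eq image_image using assms by (simp add: action_double_coset)
qed

text \<open>
  For \<open>g = 1\<close> the set \<open>V0 \<Gamma>(v) V0\<close> is the union of the \<open>\<Gamma>\<close>-orbit of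
  the double coset of \<open>v\<close>, and each member of the orbit has finitely many left cosets.
\<close>

lemma finite_left_cosets_orbit_double_coset_one_iff:
  assumes "hecke_pair V V0" "v \<in> carrier V"
  shows "finite (left_cosets_of V (orbit_double_coset v \<one>\<^bsub>G\<^esub>) V0)
    \<longleftrightarrow> finite (double_coset V V0 ` subgroup_orbit G \<Gamma> \<alpha> v)"
proof -
  have X: "subgroup_orbit G \<Gamma> \<alpha> v \<subseteq> carrier V" using assms(2) by (auto simp: orbit_eq)
  have un: "orbit_double_coset v \<one>\<^bsub>G\<^esub> = (\<Union>w\<in>subgroup_orbit G \<Gamma> \<alpha> v. (V0 #>\<^bsub>V\<^esub> w) <#>\<^bsub>V\<^esub> V0)"
    unfolding orbit_double_coset_eq_Union coset_stabilizer_one action_image_id[OF V0_carrier] ..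
  show ?thesis
  proof
    assume "finite (left_cosets_of V (orbit_double_coset v \<one>\<^bsub>G\<^esub>) V0)"
    then show "finite (double_coset V V0 ` subgroup_orbit G \<Gamma> \<alpha> v)"
      using V.card_left_cosets_Union(1)[OF V0 V0 X un] by (simp add: double_coset_def)
  next
    assume fin: "finite (double_coset V V0 ` subgroup_orbit G \<Gamma> \<alpha> v)"
    have "finite (left_cosets_of V (double_coset V V0 w) V0)" if "w \<in> subgroup_orbit G \<Gamma> \<alpha> v" for w
    proof -
      have w: "w \<in> carrier V" using that X by blast
      then have "finite_index V V0 (V0 \<inter> conj_subgroup V w V0)"
        using assms(1) by (simp add: hecke_pair_def)
      then show ?thesis
        using eqpoll_finite_iff[OF V.left_cosets_of_double_coset[OF V0 V0 w]]
        by (simp add: finite_index_def double_coset_def)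
    qed
    moreover have "left_cosets_of V (orbit_double_coset v \<one>\<^bsub>G\<^esub>) V0
        = (\<Union>D\<in>double_coset V V0 ` subgroup_orbit G \<Gamma> \<alpha> v. left_cosets_of V D V0)"
      unfolding un left_cosets_of_def double_coset_def by auto
    ultimately show "finite (left_cosets_of V (orbit_double_coset v \<one>\<^bsub>G\<^esub>) V0)"
      using finite_UN_I[OF fin, of "\<lambda>D. left_cosets_of V D V0"] by force
  qed
qed

lemma finite_orbits_iff:
  "finite_orbits_on_double_cosets V V0 G \<Gamma> \<alpha> \<longleftrightarrow>
    (\<forall>v\<in>carrier V. finite (double_coset V V0 ` subgroup_orbit G \<Gamma> \<alpha> v))"
  by (auto simp: finite_orbits_on_double_cosets_def double_cosets_def orbit_of_double_coset)

lemma index_inverse_translate: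
  assumes "g \<in> carrier G"
  shows "sub_index V V0 (V0 \<inter> \<alpha> (inv\<^bsub>G\<^esub> g) ` V0) = sub_index V (\<alpha> g ` V0) (V0 \<inter> \<alpha> g ` V0)"
    and "finite_index V V0 (V0 \<inter> \<alpha> (inv\<^bsub>G\<^esub> g) ` V0) \<longleftrightarrow> finite_index V (\<alpha> g ` V0) (V0 \<inter> \<alpha> g ` V0)"
proof -
  have "\<alpha> g ` \<alpha> (inv\<^bsub>G\<^esub> g) ` V0 = V0"
    using assms V0_carrier action_image_comp[of V0 g "inv\<^bsub>G\<^esub> g"] by (simp add: action_image_id)
  then show "sub_index V V0 (V0 \<inter> \<alpha> (inv\<^bsub>G\<^esub> g) ` V0) = sub_index V (\<alpha> g ` V0) (V0 \<inter> \<alpha> g ` V0)"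
    and "finite_index V V0 (V0 \<inter> \<alpha> (inv\<^bsub>G\<^esub> g) ` V0) \<longleftrightarrow> finite_index V (\<alpha> g ` V0) (V0 \<inter> \<alpha> g ` V0)"
    using V.sub_index_automorphism[OF action_automorphism(1,2)[OF assms] V0
        action_image_subgroup[OF V0, of "inv\<^bsub>G\<^esub> g"]] assms
    by (simp_all add: Int_commute)
qed

text \<open>
  The element \<open>(v, 1)\<close> gives the conditions on \<open>V0\<close> and on the orbits. The elements
  \<open>(1, g)\<close> and \<open>(1, g\<^sup>-\<^sup>1)\<close> give the two indices in the commensurability of \<open>V0\<close> and
  \<open>g (V0)\<close>.
\<close>

lemma hecke_pair_semidirect_imp:
  assumes "hecke_pair VG (V0 \<times> \<Gamma>)"
  shows "hecke_pair V V0" "finite_orbits_on_double_cosets V V0 G \<Gamma> \<alpha>" "hecke_pair G \<Gamma>"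
    and "\<And>g. g \<in> carrier G \<Longrightarrow> commensurable V V0 (\<alpha> g ` V0)"
proof -
  have fin: "finite (left_cosets_of V (orbit_double_coset v g) (\<alpha> g ` V0))"
    if "v \<in> carrier V" "g \<in> carrier G" for v g
    using assms that by (simp add: hecke_pair_semidirect_iff)
  show "hecke_pair G \<Gamma>" using assms by (simp add: hecke_pair_semidirect_iff)
  have "finite_index V V0 (V0 \<inter> conj_subgroup V v V0)" if "v \<in> carrier V" for v
    using finite_index_of_orbit_double_coset[OF that _ fin[OF that G.one_closed]]
    by (simp add: action_image_id[OF V0_carrier])
  then show hp: "hecke_pair V V0"
    using V.is_group V0 by (simp add: hecke_pair_def)
  show "finite_orbits_on_double_cosets V V0 G \<Gamma> \<alpha>"
    unfolding finite_orbits_iff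
    using fin[OF _ G.one_closed] finite_left_cosets_orbit_double_coset_one_iff[OF hp]
    by (simp add: action_image_id[OF V0_carrier])
  have one: "finite_index V V0 (V0 \<inter> \<alpha> g ` V0)" if "g \<in> carrier G" for g
  proof -
    have "\<alpha> g ` V0 \<subseteq> carrier V" using that by auto
    then show ?thesis
      using finite_index_of_orbit_double_coset[OF _ that fin[OF _ that], of "\<one>\<^bsub>V\<^esub>"]
      by (simp add: V.conj_subgroup_one)
  qed
  show "commensurable V V0 (\<alpha> g ` V0)" if "g \<in> carrier G" for g
    using one[OF that] one[of "inv\<^bsub>G\<^esub> g"] that
    by (simp add: commensurable_def index_inverse_translate(2))
qed

text \<open>
  The set \<open>V0 \<Gamma>(v) V0\<close> is covered by finitely many left cosets of \<open>V0\<close>, and each of these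
  by finitely many left cosets of \<open>g (V0)\<close>.
\<close>

lemma hecke_pair_semidirectI:
  assumes "hecke_pair V V0" "finite_orbits_on_double_cosets V V0 G \<Gamma> \<alpha>" "hecke_pair G \<Gamma>"
    and com: "\<And>g. g \<in> carrier G \<Longrightarrow> commensurable V V0 (\<alpha> g ` V0)"
  shows "hecke_pair VG (V0 \<times> \<Gamma>)"
  unfolding hecke_pair_semidirect_iff
proof (intro conjI ballI assms(3))
  fix v g assume v: "v \<in> carrier V" and g: "g \<in> carrier G"
  define S where "S = V0 <#>\<^bsub>V\<^esub> subgroup_orbit G (coset_stabilizer g) \<alpha> v"
  have "S \<subseteq> orbit_double_coset v \<one>\<^bsub>G\<^esub>"
  proof
    fix s assume "s \<in> S"
    then obtain a \<delta> where "a \<in> V0" "\<delta> \<in> coset_stabilizer g" "s = a \<otimes>\<^bsub>V\<^esub> \<alpha> \<delta> v"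
      by (auto simp: S_def orbit_eq set_mult_def)
    then show "s \<in> orbit_double_coset v \<one>\<^bsub>G\<^esub>"
      using v subgroup.one_closed[OF V0] coset_stabilizer_mem[of \<delta> g]
      unfolding orbit_double_coset_eq_image coset_stabilizer_one
      by (intro image_eqI[of _ _ "(a, \<delta>, \<one>\<^bsub>V\<^esub>)"]) simp_all
  qed
  moreover have "finite (left_cosets_of V (orbit_double_coset v \<one>\<^bsub>G\<^esub>) V0)"
    using assms(2) v by (simp add: finite_left_cosets_orbit_double_coset_one_iff[OF assms(1) v] finite_orbits_iff)
  ultimately have finS: "finite (left_cosets_of V S V0)"
    unfolding left_cosets_of_def by (meson finite_subset image_mono)
  have S: "S \<subseteq> carrier V"
    unfolding S_def using V0_carrier orbit_carrier[OF v] by (rule V.set_mult_closed)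
  have gV0: "subgroup (\<alpha> g ` V0) V" using V0 g by (rule action_image_subgroup)
  have "finite (left_cosets_of V V0 (\<alpha> g ` V0))"
    using com[OF g] V.finite_index_Int_iff[OF V0 gV0] by (simp add: commensurable_def)
  with finS have "finite (left_cosets_of V S (\<alpha> g ` V0))"
    using V.finite_left_cosets_trans[OF V0 subgroup.subset[OF gV0] S] by blast
  then show "finite (left_cosets_of V (orbit_double_coset v g) (\<alpha> g ` V0))"
    unfolding orbit_double_coset_def S_def[symmetric] V.left_cosets_of_set_mult[OF gV0 S] .
qed

section \<open>The modular function\<close>

lemma hecke_modular_invariant:
  assumes "\<gamma> \<in> \<Gamma>" "v \<in> carrier V"
  shows "hecke_modular V V0 (\<alpha> \<gamma> v) = hecke_modular V V0 v"
proof -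
  have "conj_subgroup V (\<alpha> \<gamma> v) V0 = \<alpha> \<gamma> ` conj_subgroup V v V0"
    using assms by (simp add: conj_subgroup_action V0_carrier invariant)
  then have "relative_index V V0 (conj_subgroup V (\<alpha> \<gamma> v) V0) = relative_index V V0 (conj_subgroup V v V0)"
    using relative_index_action(1)[OF V0 V.conj_subgroup_is_subgroup[OF V0 assms(2)], of \<gamma>] assms
    by (simp add: invariant)
  then show ?thesis
    using assms by (simp add: V.hecke_modular_eq_relative_index[OF V0])
qed

text \<open>
  The path from \<open>V0\<close> to \<open>v g(V0) v\<^sup>-\<^sup>1\<close> passes through \<open>v V0 v\<^sup>-\<^sup>1\<close>.
\<close>

lemma relative_index_conj_translate:
  assumes hp: "hecke_pair V V0" and com: "commensurable V V0 (\<alpha> g ` V0)"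
    and v: "v \<in> carrier V" and g: "g \<in> carrier G"
  shows "commensurable V V0 (conj_subgroup V v (\<alpha> g ` V0))"
    and "relative_index V V0 (conj_subgroup V v (\<alpha> g ` V0))
      = hecke_modular V V0 v * relative_index V V0 (\<alpha> g ` V0)"
proof -
  have gV0: "subgroup (\<alpha> g ` V0) V" using V0 g by (rule action_image_subgroup)
  note sub = V.conj_subgroup_is_subgroup[OF V0 v] V.conj_subgroup_is_subgroup[OF gV0 v]
  have "commensurable V V0 (conj_subgroup V v V0)" using hp v by (rule V.hecke_pair_commensurable)
  moreover have "commensurable V (conj_subgroup V v V0) (conj_subgroup V v (\<alpha> g ` V0))"
    and rel: "relative_index V (conj_subgroup V v V0) (conj_subgroup V v (\<alpha> g ` V0))
      = relative_index V V0 (\<alpha> g ` V0)"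
    using V.relative_index_automorphism[OF V.conj_hom[OF v] V0 gV0] com
    by (simp_all add: V.conj_subgroup_image)
  ultimately show "commensurable V V0 (conj_subgroup V v (\<alpha> g ` V0))"
    and "relative_index V V0 (conj_subgroup V v (\<alpha> g ` V0))
      = hecke_modular V V0 v * relative_index V V0 (\<alpha> g ` V0)"
    using V.commensurable_trans_relative_index[OF V0 sub] rel
    by (simp_all add: V.hecke_modular_eq_relative_index[OF V0 v])
qed

text \<open>
  The set \<open>V0 O g(V0)\<close> is a union of double cosets \<open>V0 w g(V0)\<close> with \<open>w\<close> in an
  orbit inside \<open>\<Gamma>(v)\<close>. The ratio of left to right cosets is \<open>[V0 : w g(V0) w\<^sup>-\<^sup>1]\<close>,
  which is the modular function of \<open>V0\<close> at \<open>w\<close> times \<open>[V0 : g(V0)]\<close>; by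
  invariance under \<open>\<Gamma>\<close> it is the same for all \<open>w\<close>.
\<close>

lemma hecke_modular_semidirect:
  assumes pair: "hecke_pair VG (V0 \<times> \<Gamma>)" and v: "v \<in> carrier V" and g: "g \<in> carrier G"
  shows "hecke_modular VG (V0 \<times> \<Gamma>) (v, g) = hecke_modular V V0 v * hecke_modular G \<Gamma> g *
    (real (sub_index V V0 (V0 \<inter> \<alpha> g ` V0)) / real (sub_index V V0 (V0 \<inter> \<alpha> (inv\<^bsub>G\<^esub> g) ` V0)))"
proof -
  note conds = hecke_pair_semidirect_imp[OF pair]
  define r where "r = hecke_modular V V0 v * relative_index V V0 (\<alpha> g ` V0)"
  have gV0: "subgroup (\<alpha> g ` V0) V" using V0 g by (rule action_image_subgroup)
  have finL: "finite (left_cosets_of V (orbit_double_coset v g) (\<alpha> g ` V0))"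
    using pair v g by (simp add: hecke_pair_semidirect_iff)
  have finR: "finite (right_cosets_of V V0 (orbit_double_coset v g))"
    using pair v g eqpoll_finite_iff[OF right_cosets_orbit_double_coset[OF v g]]
    by (simp add: hecke_pair_semidirect_iff)
  have "commensurable V V0 (conj_subgroup V w (\<alpha> g ` V0))
      \<and> relative_index V V0 (conj_subgroup V w (\<alpha> g ` V0)) = r"
    if orb: "w \<in> subgroup_orbit G (coset_stabilizer g) \<alpha> v" for w
  proof -
    obtain \<delta> where "\<delta> \<in> coset_stabilizer g" and w: "w = \<alpha> \<delta> v"
      using orb by (auto simp: orbit_eq)
    then have \<delta>: "\<delta> \<in> \<Gamma>" by (intro coset_stabilizer_mem)
    then have "w \<in> carrier V" using v w by simp
    then show ?thesis
      using relative_index_conj_translate[OF conds(1) conds(4)[OF g] _ g, of w]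
        hecke_modular_invariant[OF \<delta> v]
      by (simp add: r_def w)
  qed
  then have ratio: "real (card (left_cosets_of V (orbit_double_coset v g) (\<alpha> g ` V0)))
      = r * real (card (right_cosets_of V V0 (orbit_double_coset v g)))"
    by (intro V.card_cosets_ratio_Union[OF V0 gV0 orbit_carrier[OF v] orbit_double_coset_eq_Union finL finR])
      auto
  have "right_cosets_of V V0 (orbit_double_coset v g) \<noteq> {}"
    using left_cosets_orbit_double_coset_nonempty[OF v g] by (auto simp: left_cosets_of_def right_cosets_of_def)
  then have "card (right_cosets_of V V0 (orbit_double_coset v g)) \<noteq> 0" using finR by simp
  then have "real (hecke_L VG (V0 \<times> \<Gamma>) (v, g)) / real (hecke_R VG (V0 \<times> \<Gamma>) (v, g))
      = real (hecke_L G \<Gamma> g) / real (hecke_R G \<Gamma> g) * r"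
    by (simp add: hecke_L_semidirect[OF v g] hecke_R_semidirect[OF v g] ratio)
  then have "hecke_modular VG (V0 \<times> \<Gamma>) (v, g) = hecke_modular G \<Gamma> g * r"
    by (simp add: hecke_modular_def hecke_R_def)
  then show ?thesis
    by (simp add: r_def relative_index_def index_inverse_translate(1)[OF g])
qed

end

section \<open>Embedding of Hecke algebras\<close>

lemma hecke_functions_outside: "f \<in> hecke_functions N H \<Longrightarrow> x \<notin> carrier N \<Longrightarrow> f x = 0"
  by (simp add: hecke_functions_def)

lemma hecke_functions_biinvariant:
  "f \<in> hecke_functions N H \<Longrightarrow> x \<in> carrier N \<Longrightarrow> h \<in> H \<Longrightarrow> k \<in> H
    \<Longrightarrow> f (h \<otimes>\<^bsub>N\<^esub> x \<otimes>\<^bsub>N\<^esub> k) = f x"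
  by (simp add: hecke_functions_def)

context group
begin

lemma hecke_functions_left_invariant:
  assumes "subgroup H G" "f \<in> hecke_functions G H" "x \<in> carrier G" "h \<in> H"
  shows "f (h \<otimes> x) = f x"
  using hecke_functions_biinvariant[OF assms(2,3,4) subgroup.one_closed[OF assms(1)]] assms
  by (simp add: subgroup.mem_carrier)

lemma hecke_functions_right_invariant:
  assumes "subgroup H G" "f \<in> hecke_functions G H" "x \<in> carrier G" "h \<in> H"
  shows "f (x \<otimes> h) = f x"
  using hecke_functions_biinvariant[OF assms(2,3) subgroup.one_closed[OF assms(1)] assms(4)] assms
  by simp

lemma hecke_conv_summand:
  assumes H: "subgroup H G" and f: "f1 \<in> hecke_functions G H" "f2 \<in> hecke_functions G H"
    and x: "x \<in> carrier G" and w: "w \<in> carrier G"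
  shows "(let y = (SOME y. y \<in> H #> w) in f1 (x \<otimes> inv y) * f2 y) = f1 (x \<otimes> inv w) * f2 w"
proof -
  define y where "y = (SOME y. y \<in> H #> w)"
  have "y \<in> H #> w" unfolding y_def by (rule someI, rule rcos_self[OF w H])
  then obtain h where h: "h \<in> H" "y = h \<otimes> w" by (auto simp: r_coset_def)
  have hc: "h \<in> carrier G" using h H by (simp add: subgroup.mem_carrier)
  have "x \<otimes> inv y = (x \<otimes> inv w) \<otimes> inv h"
    using h hc x w by (simp add: inv_mult_group m_assoc)
  then have "f1 (x \<otimes> inv y) = f1 (x \<otimes> inv w)"
    using hecke_functions_right_invariant[OF H f(1), of "x \<otimes> inv w" "inv h"] h(1) H x w
    by (simp add: subgroup.m_inv_closed)
  moreover have "f2 y = f2 w"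
    using hecke_functions_left_invariant[OF H f(2) w h(1)] h(2) by simp
  ultimately show ?thesis unfolding y_def[symmetric] by (simp add: Let_def)
qed

text \<open>
  The index set of the convolution sum, written as a family of cosets indexed by the points of the
  support.
\<close>

lemma rcosets_meeting_support:
  assumes "subgroup H G"
  shows "{C \<in> rcosets H. \<exists>y\<in>C. P y} = (\<lambda>y. H #> y) ` {y \<in> carrier G. P y}"
proof (intro equalityI subsetI)
  fix C assume "C \<in> {C \<in> rcosets H. \<exists>y\<in>C. P y}"
  then obtain x y where x: "x \<in> carrier G" "C = H #> x" and y: "y \<in> C" "P y"
    by (auto simp: RCOSETS_def)
  then have "C = H #> y" "y \<in> carrier G"
    using assms repr_independence[of y H x] r_coset_subset_G[of H x] by (auto simp: subgroup.subset)
  then show "C \<in> (\<lambda>y. H #> y) ` {y \<in> carrier G. P y}" using y by blast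
next
  fix C assume "C \<in> (\<lambda>y. H #> y) ` {y \<in> carrier G. P y}"
  then show "C \<in> {C \<in> rcosets H. \<exists>y\<in>C. P y}"
    using assms rcos_self by (force simp: RCOSETS_def)
qed

end

context invariant_subgroups
begin

text \<open>
  The restriction of this map to the \<open>\<Gamma>\<close>-invariant functions is the embedding of Hecke algebras.
\<close>

definition hecke_extension :: "('v \<Rightarrow> complex) \<Rightarrow> 'v \<times> 'g \<Rightarrow> complex" where
  "hecke_extension f = (\<lambda>(v, g). if g \<in> \<Gamma> then f v else 0)"

lemma hecke_extension_apply [simp]: "hecke_extension f (v, g) = (if g \<in> \<Gamma> then f v else 0)"
  by (simp add: hecke_extension_def)

lemma fixed_algebra_carrier:
  "f \<in> carrier (hecke_fixed_algebra V V0 G \<Gamma> \<alpha>) \<longleftrightarrow>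
    f \<in> hecke_functions V V0 \<and> (\<forall>\<gamma>\<in>\<Gamma>. function_action V G \<alpha> \<gamma> f = f)"
  by (simp add: hecke_fixed_algebra_def)

lemma fixed_function_invariant:
  assumes "f \<in> carrier (hecke_fixed_algebra V V0 G \<Gamma> \<alpha>)" "\<gamma> \<in> \<Gamma>" "v \<in> carrier V"
  shows "f (\<alpha> \<gamma> v) = f v"
proof -
  have "function_action V G \<alpha> (inv\<^bsub>G\<^esub> \<gamma>) f = f"
    using assms(1,2) \<Gamma> by (simp add: fixed_algebra_carrier subgroup.m_inv_closed)
  from fun_cong[OF this, of v] show ?thesis
    using assms(2,3) by (simp add: function_action_def)
qed

lemma \<Gamma>_mult_iff:
  assumes "\<gamma> \<in> \<Gamma>" "\<delta> \<in> \<Gamma>" "g \<in> carrier G"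
  shows "\<gamma> \<otimes>\<^bsub>G\<^esub> g \<otimes>\<^bsub>G\<^esub> \<delta> \<in> \<Gamma> \<longleftrightarrow> g \<in> \<Gamma>"
proof
  assume "\<gamma> \<otimes>\<^bsub>G\<^esub> g \<otimes>\<^bsub>G\<^esub> \<delta> \<in> \<Gamma>"
  then have "inv\<^bsub>G\<^esub> \<gamma> \<otimes>\<^bsub>G\<^esub> (\<gamma> \<otimes>\<^bsub>G\<^esub> g \<otimes>\<^bsub>G\<^esub> \<delta>) \<otimes>\<^bsub>G\<^esub> inv\<^bsub>G\<^esub> \<delta> \<in> \<Gamma>"
    using assms \<Gamma> by (simp add: subgroup.m_closed subgroup.m_inv_closed)
  also have "inv\<^bsub>G\<^esub> \<gamma> \<otimes>\<^bsub>G\<^esub> (\<gamma> \<otimes>\<^bsub>G\<^esub> g \<otimes>\<^bsub>G\<^esub> \<delta>) \<otimes>\<^bsub>G\<^esub> inv\<^bsub>G\<^esub> \<delta> = g"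
    using assms by (simp add: G.m_assoc) (simp flip: G.m_assoc)
  finally show "g \<in> \<Gamma>" .
qed (use assms \<Gamma> in \<open>simp add: subgroup.m_closed\<close>)

text \<open>
  The elements \<open>(v, \<gamma>)\<close>, \<open>(v, 1)\<close> and \<open>(w, 1)\<close> differ by factors from
  \<open>V0 \<times> \<Gamma>\<close>. Thus the double coset of \<open>(v, \<gamma>)\<close> depends only on the double coset of \<open>v\<close>, so
  that finitely many double cosets in a support remain finitely many under the extension.
\<close>

lemma double_coset_extension:
  assumes "v \<in> carrier V" "\<gamma> \<in> \<Gamma>" "w \<in> double_coset V V0 v"
  shows "double_coset VG (V0 \<times> \<Gamma>) (v, \<gamma>) = double_coset VG (V0 \<times> \<Gamma>) (w, \<one>\<^bsub>G\<^esub>)"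
proof -
  have one: "\<one>\<^bsub>V\<^esub> \<in> V0" "\<one>\<^bsub>G\<^esub> \<in> \<Gamma>" using V0 \<Gamma> by (simp_all add: subgroup.one_closed)
  obtain a b where ab: "a \<in> V0" "b \<in> V0" "w = a \<otimes>\<^bsub>V\<^esub> v \<otimes>\<^bsub>V\<^esub> b"
    using assms(3) by (auto simp: double_coset_def V.double_coset_eq_image)
  have v1: "(v, \<one>\<^bsub>G\<^esub>) \<in> carrier VG" using assms(1) by simp
  have "(v, \<gamma>) \<in> ((V0 \<times> \<Gamma>) #>\<^bsub>VG\<^esub> (v, \<one>\<^bsub>G\<^esub>)) <#>\<^bsub>VG\<^esub> (V0 \<times> \<Gamma>)"
    unfolding VG.double_coset_eq_image using assms one
    by (intro image_eqI[of _ _ "((\<one>\<^bsub>V\<^esub>, \<one>\<^bsub>G\<^esub>), (\<one>\<^bsub>V\<^esub>, \<gamma>))"]) simp_all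
  moreover have "(w, \<one>\<^bsub>G\<^esub>) \<in> ((V0 \<times> \<Gamma>) #>\<^bsub>VG\<^esub> (v, \<one>\<^bsub>G\<^esub>)) <#>\<^bsub>VG\<^esub> (V0 \<times> \<Gamma>)"
    unfolding VG.double_coset_eq_image using assms one ab
    by (intro image_eqI[of _ _ "((a, \<one>\<^bsub>G\<^esub>), (b, \<one>\<^bsub>G\<^esub>))"]) simp_all
  ultimately show ?thesis
    unfolding double_coset_def
    using VG.double_coset_eqI[OF product_subgroup product_subgroup v1] by simp
qed

lemma hecke_extension_closed:
  assumes f: "f \<in> carrier (hecke_fixed_algebra V V0 G \<Gamma> \<alpha>)"
  shows "hecke_extension f \<in> hecke_functions VG (V0 \<times> \<Gamma>)"
proof -
  have fV: "f \<in> hecke_functions V V0" using f by (simp add: fixed_algebra_carrier)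
  have outside: "hecke_extension f x = 0" if "x \<notin> carrier VG" for x
    using that hecke_functions_outside[OF fV] by (cases x) auto
  have biinv: "hecke_extension f (h \<otimes>\<^bsub>VG\<^esub> x \<otimes>\<^bsub>VG\<^esub> k) = hecke_extension f x"
    if x: "x \<in> carrier VG" and h: "h \<in> V0 \<times> \<Gamma>" and k: "k \<in> V0 \<times> \<Gamma>" for x h k
  proof -
    obtain v g a \<gamma> b \<delta> where eqs: "x = (v, g)" "h = (a, \<gamma>)" "k = (b, \<delta>)"
      and mem: "v \<in> carrier V" "g \<in> carrier G" "a \<in> V0" "\<gamma> \<in> \<Gamma>" "b \<in> V0" "\<delta> \<in> \<Gamma>"
      using x h k by auto
    show ?thesis
    proof (cases "g \<in> \<Gamma>")
      case True
      then have "\<gamma> \<otimes>\<^bsub>G\<^esub> g \<in> \<Gamma>" using mem \<Gamma> by (simp add: subgroup.m_closed)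
      then have "\<alpha> (\<gamma> \<otimes>\<^bsub>G\<^esub> g) b \<in> V0" using mem by (simp add: invariant_mem_iff)
      then have "f (a \<otimes>\<^bsub>V\<^esub> \<alpha> \<gamma> v \<otimes>\<^bsub>V\<^esub> \<alpha> (\<gamma> \<otimes>\<^bsub>G\<^esub> g) b) = f (\<alpha> \<gamma> v)"
        using hecke_functions_biinvariant[OF fV] mem by simp
      then show ?thesis
        using mem True by (simp add: eqs \<Gamma>_mult_iff fixed_function_invariant[OF f])
    next
      case False
      then show ?thesis using mem by (simp add: eqs \<Gamma>_mult_iff)
    qed
  qed
  define E where "E D = double_coset VG (V0 \<times> \<Gamma>) (SOME w. w \<in> D, \<one>\<^bsub>G\<^esub>)" for D
  have "double_coset VG (V0 \<times> \<Gamma>) ` {x \<in> carrier VG. hecke_extension f x \<noteq> 0}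
      \<subseteq> E ` double_coset V V0 ` {v \<in> carrier V. f v \<noteq> 0}"
  proof
    fix D assume "D \<in> double_coset VG (V0 \<times> \<Gamma>) ` {x \<in> carrier VG. hecke_extension f x \<noteq> 0}"
    then obtain v g where v: "v \<in> carrier V" "f v \<noteq> 0" and g: "g \<in> \<Gamma>"
      and D: "D = double_coset VG (V0 \<times> \<Gamma>) (v, g)"
      by (auto split: if_splits)
    have "v \<in> double_coset V V0 v"
      using V.mem_double_coset_self[OF V0 V0 v(1)] by (simp add: double_coset_def)
    then have "(SOME w. w \<in> double_coset V V0 v) \<in> double_coset V V0 v" by (rule someI)
    then have "D = E (double_coset V V0 v)"
      unfolding D E_def using v(1) g by (intro double_coset_extension)
    then show "D \<in> E ` double_coset V V0 ` {v \<in> carrier V. f v \<noteq> 0}" using v by blast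
  qed
  moreover have "finite (double_coset V V0 ` {v \<in> carrier V. f v \<noteq> 0})"
    using fV by (simp add: hecke_functions_def)
  ultimately have "finite (double_coset VG (V0 \<times> \<Gamma>) ` {x \<in> carrier VG. hecke_extension f x \<noteq> 0})"
    by (meson finite_imageI finite_subset)
  then show ?thesis
    unfolding hecke_functions_def using outside biinv by blast
qed

text \<open>
  Every right coset of \<open>V0 \<times> \<Gamma>\<close> in \<open>V \<times> \<Gamma>\<close> has a representative with second
  component \<open>g\<close>. Choosing the \<open>g\<close> of the point at which a convolution is evaluated
  makes \<open>(v, g) (w, g)\<^sup>-\<^sup>1 = (v w\<^sup>-\<^sup>1, 1)\<close> free of the action.
\<close>

lemma rcosets_meeting_extension_support:
  assumes f: "f \<in> carrier (hecke_fixed_algebra V V0 G \<Gamma> \<alpha>)" and g: "g \<in> \<Gamma>"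
  shows "{C \<in> rcosets\<^bsub>VG\<^esub> (V0 \<times> \<Gamma>). \<exists>y\<in>C. hecke_extension f y \<noteq> 0}
    = (\<lambda>w. (V0 \<times> \<Gamma>) #>\<^bsub>VG\<^esub> (w, g)) ` {w \<in> carrier V. f w \<noteq> 0}"
  unfolding VG.rcosets_meeting_support[OF product_subgroup]
proof (intro equalityI subsetI)
  fix C assume "C \<in> (\<lambda>y. (V0 \<times> \<Gamma>) #>\<^bsub>VG\<^esub> y) ` {y \<in> carrier VG. hecke_extension f y \<noteq> 0}"
  then obtain u \<eta> where u: "u \<in> carrier V" "f u \<noteq> 0" and \<eta>: "\<eta> \<in> \<Gamma>"
    and C: "C = (V0 \<times> \<Gamma>) #>\<^bsub>VG\<^esub> (u, \<eta>)"
    by (auto split: if_splits)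
  \<comment> \<open>Left multiplication by \<open>(1, \<gamma>)\<close> moves \<open>(u, \<eta>)\<close> to \<open>(\<gamma>(u), g)\<close>.\<close>
  define \<gamma> where "\<gamma> = g \<otimes>\<^bsub>G\<^esub> inv\<^bsub>G\<^esub> \<eta>"
  have \<gamma>: "\<gamma> \<in> \<Gamma>" unfolding \<gamma>_def using g \<eta> \<Gamma> by (simp add: subgroup.m_closed subgroup.m_inv_closed)
  have "(\<alpha> \<gamma> u, g) \<otimes>\<^bsub>VG\<^esub> inv\<^bsub>VG\<^esub> (u, \<eta>) = (\<one>\<^bsub>V\<^esub>, \<gamma>)"
    using u \<eta> g by (simp add: \<gamma>_def action_comp)
  then have "(\<alpha> \<gamma> u, g) \<otimes>\<^bsub>VG\<^esub> inv\<^bsub>VG\<^esub> (u, \<eta>) \<in> V0 \<times> \<Gamma>"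
    using \<gamma> subgroup.one_closed[OF V0] by simp
  then have "(V0 \<times> \<Gamma>) #>\<^bsub>VG\<^esub> (\<alpha> \<gamma> u, g) = C"
    unfolding C using u \<eta> \<gamma> g VG.r_coset_eq_iff[OF product_subgroup, of "(\<alpha> \<gamma> u, g)" "(u, \<eta>)"]
    by simp
  moreover have "f (\<alpha> \<gamma> u) \<noteq> 0" using fixed_function_invariant[OF f \<gamma> u(1)] u(2) by simp
  ultimately show "C \<in> (\<lambda>w. (V0 \<times> \<Gamma>) #>\<^bsub>VG\<^esub> (w, g)) ` {w \<in> carrier V. f w \<noteq> 0}"
    using u \<gamma> by (intro image_eqI[of _ _ "\<alpha> \<gamma> u"]) simp_all
next
  fix C assume "C \<in> (\<lambda>w. (V0 \<times> \<Gamma>) #>\<^bsub>VG\<^esub> (w, g)) ` {w \<in> carrier V. f w \<noteq> 0}"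
  then show "C \<in> (\<lambda>y. (V0 \<times> \<Gamma>) #>\<^bsub>VG\<^esub> y) ` {y \<in> carrier VG. hecke_extension f y \<noteq> 0}"
    using g by auto
qed

text \<open>
  At a point \<open>(v, g)\<close> with \<open>g \<in> \<Gamma>\<close>, the correspondence
  \<open>V0 w \<mapsto> (V0 \<times> \<Gamma>)(w, g)\<close> matches the two sums term by term. For
  \<open>g \<notin> \<Gamma>\<close> every term vanishes, since \<open>g h\<^sup>-\<^sup>1\<close> and \<open>h\<close> cannot both lie in
  \<open>\<Gamma>\<close>.
\<close>

lemma hecke_extension_conv:
  assumes f1: "f1 \<in> carrier (hecke_fixed_algebra V V0 G \<Gamma> \<alpha>)"
    and f2: "f2 \<in> carrier (hecke_fixed_algebra V V0 G \<Gamma> \<alpha>)"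
  shows "hecke_extension (hecke_conv V V0 f1 f2)
    = hecke_conv VG (V0 \<times> \<Gamma>) (hecke_extension f1) (hecke_extension f2)"
proof
  fix x :: "'v \<times> 'g"
  obtain v g where x: "x = (v, g)" by force
  note fV = f1[unfolded fixed_algebra_carrier, THEN conjunct1] f2[unfolded fixed_algebra_carrier, THEN conjunct1]
  note fE = hecke_extension_closed[OF f1] hecke_extension_closed[OF f2]
  consider "v \<notin> carrier V \<or> g \<notin> carrier G" | "v \<in> carrier V" "g \<in> carrier G" "g \<notin> \<Gamma>"
    | "v \<in> carrier V" "g \<in> \<Gamma>" by blast
  then show "hecke_extension (hecke_conv V V0 f1 f2) x
      = hecke_conv VG (V0 \<times> \<Gamma>) (hecke_extension f1) (hecke_extension f2) x"
  proof cases
    case 1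
    then show ?thesis by (auto simp: x hecke_conv_def)
  next
    case 2
    have "(let y = (SOME y. y \<in> C) in hecke_extension f1 (x \<otimes>\<^bsub>VG\<^esub> inv\<^bsub>VG\<^esub> y) * hecke_extension f2 y) = 0"
      if C: "C \<in> rcosets\<^bsub>VG\<^esub> (V0 \<times> \<Gamma>)" for C
    proof -
      obtain w h where wh: "w \<in> carrier V" "h \<in> carrier G" "C = (V0 \<times> \<Gamma>) #>\<^bsub>VG\<^esub> (w, h)"
        using C by (auto simp: RCOSETS_def)
      have "g \<otimes>\<^bsub>G\<^esub> inv\<^bsub>G\<^esub> h \<notin> \<Gamma>" if "h \<in> \<Gamma>"
        using \<Gamma>_mult_iff[of "\<one>\<^bsub>G\<^esub>" "inv\<^bsub>G\<^esub> h" g] 2 that \<Gamma>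
        by (simp add: subgroup.one_closed subgroup.m_inv_closed)
      then have "hecke_extension f1 (x \<otimes>\<^bsub>VG\<^esub> inv\<^bsub>VG\<^esub> (w, h)) * hecke_extension f2 (w, h) = 0"
        using wh by (simp add: x)
      then show ?thesis
        unfolding wh(3) using 2 wh(1,2)
        by (subst VG.hecke_conv_summand[OF product_subgroup fE]) (simp_all add: x)
    qed
    then show ?thesis using 2 unfolding hecke_conv_def by (simp add: x sum.neutral)
  next
    case 3
    have "hecke_conv V V0 f1 f2 v = (\<Sum>C\<in>(\<lambda>w. V0 #>\<^bsub>V\<^esub> w) ` {w \<in> carrier V. f2 w \<noteq> 0}.
        let y = (SOME y. y \<in> C) in f1 (v \<otimes>\<^bsub>V\<^esub> inv\<^bsub>V\<^esub> y) * f2 y)"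
      using 3 by (simp add: hecke_conv_def V.rcosets_meeting_support[OF V0])
    also have "\<dots> = (\<Sum>C\<in>(\<lambda>w. (V0 \<times> \<Gamma>) #>\<^bsub>VG\<^esub> (w, g)) ` {w \<in> carrier V. f2 w \<noteq> 0}.
        let y = (SOME y. y \<in> C) in hecke_extension f1 (x \<otimes>\<^bsub>VG\<^esub> inv\<^bsub>VG\<^esub> y) * hecke_extension f2 y)"
    proof (rule sum_same_kernel)
      fix w w' assume "w \<in> {w \<in> carrier V. f2 w \<noteq> 0}" "w' \<in> {w \<in> carrier V. f2 w \<noteq> 0}"
      then have ww: "w \<in> carrier V" "w' \<in> carrier V" by auto
      have "(w, g) \<otimes>\<^bsub>VG\<^esub> inv\<^bsub>VG\<^esub> (w', g) = (w \<otimes>\<^bsub>V\<^esub> inv\<^bsub>V\<^esub> w', \<one>\<^bsub>G\<^esub>)"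
        using ww 3 by simp
      then show "V0 #>\<^bsub>V\<^esub> w = V0 #>\<^bsub>V\<^esub> w' \<longleftrightarrow>
          (V0 \<times> \<Gamma>) #>\<^bsub>VG\<^esub> (w, g) = (V0 \<times> \<Gamma>) #>\<^bsub>VG\<^esub> (w', g)"
        using ww 3 VG.r_coset_eq_iff[OF product_subgroup, of "(w, g)" "(w', g)"] subgroup.one_closed[OF \<Gamma>]
        by (simp add: V.r_coset_eq_iff[OF V0])
    next
      fix w assume "w \<in> {w \<in> carrier V. f2 w \<noteq> 0}"
      then have w: "w \<in> carrier V" by simp
      have "(v, g) \<otimes>\<^bsub>VG\<^esub> inv\<^bsub>VG\<^esub> (w, g) = (v \<otimes>\<^bsub>V\<^esub> inv\<^bsub>V\<^esub> w, \<one>\<^bsub>G\<^esub>)"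
        using w 3 by simp
      then show "(let y = SOME y. y \<in> V0 #>\<^bsub>V\<^esub> w in f1 (v \<otimes>\<^bsub>V\<^esub> inv\<^bsub>V\<^esub> y) * f2 y) =
        (let y = SOME y. y \<in> (V0 \<times> \<Gamma>) #>\<^bsub>VG\<^esub> (w, g)
         in hecke_extension f1 (x \<otimes>\<^bsub>VG\<^esub> inv\<^bsub>VG\<^esub> y) * hecke_extension f2 y)"
        using w 3 subgroup.one_closed[OF \<Gamma>]
        by (subst V.hecke_conv_summand[OF V0 fV] VG.hecke_conv_summand[OF product_subgroup fE], simp_all add: x)+
    qed
    also have "\<dots> = hecke_conv VG (V0 \<times> \<Gamma>) (hecke_extension f1) (hecke_extension f2) x"
      using 3 by (simp add: hecke_conv_def rcosets_meeting_extension_support[OF f2] x)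
    finally show ?thesis using 3 by (simp add: x)
  qed
qed

lemma hecke_extension_star:
  assumes f: "f \<in> carrier (hecke_fixed_algebra V V0 G \<Gamma> \<alpha>)"
  shows "hecke_extension (hecke_star V f) = hecke_star VG (hecke_extension f)"
proof
  fix x :: "'v \<times> 'g"
  obtain v g where x: "x = (v, g)" by force
  have inv_iff: "inv\<^bsub>G\<^esub> g \<in> \<Gamma> \<longleftrightarrow> g \<in> \<Gamma>" if "g \<in> carrier G"
    using \<Gamma> that subgroup.m_inv_closed[OF \<Gamma>, of "inv\<^bsub>G\<^esub> g"] subgroup.m_inv_closed[OF \<Gamma>, of g] by auto
  have "f (inv\<^bsub>V\<^esub> (\<alpha> (inv\<^bsub>G\<^esub> g) v)) = f (inv\<^bsub>V\<^esub> v)" if "v \<in> carrier V" "g \<in> \<Gamma>"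
    using fixed_function_invariant[OF f, of "inv\<^bsub>G\<^esub> g" "inv\<^bsub>V\<^esub> v"] that inv_iff by simp
  then show "hecke_extension (hecke_star V f) x = hecke_star VG (hecke_extension f) x"
    by (auto simp: x hecke_star_def inv_iff)
qed

lemma hecke_extension_embedding:
  "star_algebra_embedding (hecke_fixed_algebra V V0 G \<Gamma> \<alpha>) (hecke_star V)
    (hecke_algebra VG (V0 \<times> \<Gamma>)) (hecke_star VG) hecke_extension"
  unfolding star_algebra_embedding_def
proof (intro conjI allI ballI)
  show "hecke_extension \<in> ring_hom (hecke_fixed_algebra V V0 G \<Gamma> \<alpha>) (hecke_algebra VG (V0 \<times> \<Gamma>))"
  proof (rule ring_hom_memI)
    fix f1 f2
    assume f: "f1 \<in> carrier (hecke_fixed_algebra V V0 G \<Gamma> \<alpha>)" "f2 \<in> carrier (hecke_fixed_algebra V V0 G \<Gamma> \<alpha>)"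
    show "hecke_extension f1 \<in> carrier (hecke_algebra VG (V0 \<times> \<Gamma>))"
      using hecke_extension_closed[OF f(1)] by (simp add: hecke_algebra_def)
    show "hecke_extension (f1 \<otimes>\<^bsub>hecke_fixed_algebra V V0 G \<Gamma> \<alpha>\<^esub> f2)
        = hecke_extension f1 \<otimes>\<^bsub>hecke_algebra VG (V0 \<times> \<Gamma>)\<^esub> hecke_extension f2"
      using hecke_extension_conv[OF f] by (simp add: hecke_algebra_def hecke_fixed_algebra_def)
    show "hecke_extension (f1 \<oplus>\<^bsub>hecke_fixed_algebra V V0 G \<Gamma> \<alpha>\<^esub> f2)
        = hecke_extension f1 \<oplus>\<^bsub>hecke_algebra VG (V0 \<times> \<Gamma>)\<^esub> hecke_extension f2"
      by (auto simp: hecke_algebra_def hecke_fixed_algebra_def)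
  next
    show "hecke_extension \<one>\<^bsub>hecke_fixed_algebra V V0 G \<Gamma> \<alpha>\<^esub> = \<one>\<^bsub>hecke_algebra VG (V0 \<times> \<Gamma>)\<^esub>"
      by (auto simp: hecke_algebra_def hecke_fixed_algebra_def)
  qed
next
  fix c f assume "f \<in> carrier (hecke_fixed_algebra V V0 G \<Gamma> \<alpha>)"
  show "hecke_extension (c \<odot>\<^bsub>hecke_fixed_algebra V V0 G \<Gamma> \<alpha>\<^esub> f)
      = c \<odot>\<^bsub>hecke_algebra VG (V0 \<times> \<Gamma>)\<^esub> hecke_extension f"
    by (auto simp: hecke_algebra_def hecke_fixed_algebra_def)
next
  fix f assume "f \<in> carrier (hecke_fixed_algebra V V0 G \<Gamma> \<alpha>)"
  then show "hecke_extension (hecke_star V f) = hecke_star VG (hecke_extension f)"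
    by (rule hecke_extension_star)
next
  show "inj_on hecke_extension (carrier (hecke_fixed_algebra V V0 G \<Gamma> \<alpha>))"
  proof (rule inj_onI, rule ext)
    fix f1 f2 v assume "hecke_extension f1 = hecke_extension f2"
    from fun_cong[OF this, of "(v, \<one>\<^bsub>G\<^esub>)"] show "f1 v = f2 v"
      using subgroup.one_closed[OF \<Gamma>] by simp
  qed
qed

end

section \<open>Hecke pairs of semidirect products\<close>

theorem proposition1p3:
  fixes V :: "('v, 'm) monoid_scheme"
    and G :: "('g, 'n) monoid_scheme"
    and \<alpha> :: "'g \<Rightarrow> 'v \<Rightarrow> 'v"
    and V0 :: "'v set"
    and \<Gamma> :: "'g set"
  assumes "group V" and "group G"
    and "\<alpha> \<in> hom G (AutoGroup V)"
    and "subgroup V0 V" and "subgroup \<Gamma> G"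
    and "\<forall>\<gamma>\<in>\<Gamma>. \<alpha> \<gamma> ` V0 = V0"
  shows "(hecke_pair (semidirect V G \<alpha>) (V0 \<times> \<Gamma>) \<longleftrightarrow>
           (hecke_pair V V0 \<and> finite_orbits_on_double_cosets V V0 G \<Gamma> \<alpha>) \<and>
           (hecke_pair G \<Gamma> \<and> (\<forall>g\<in>carrier G. commensurable V V0 (\<alpha> g ` V0))))
       \<and> ((hecke_pair V V0 \<and> finite_orbits_on_double_cosets V V0 G \<Gamma> \<alpha>) \<and>
          (hecke_pair G \<Gamma> \<and> (\<forall>g\<in>carrier G. commensurable V V0 (\<alpha> g ` V0)))
          \<longrightarrow>
          (\<exists>\<phi>. star_algebra_embedding
                 (hecke_fixed_algebra V V0 G \<Gamma> \<alpha>) (hecke_star V)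
                 (hecke_algebra (semidirect V G \<alpha>) (V0 \<times> \<Gamma>)) (hecke_star (semidirect V G \<alpha>)) \<phi>)
          \<and> (\<forall>v\<in>carrier V. \<forall>g\<in>carrier G.
               (let \<Gamma>g = conj_subgroup G g \<Gamma> \<inter> \<Gamma>;
                    S = V0 <#>\<^bsub>V\<^esub> subgroup_orbit G \<Gamma>g \<alpha> v <#>\<^bsub>V\<^esub> \<alpha> g ` V0
                in hecke_R (semidirect V G \<alpha>) (V0 \<times> \<Gamma>) (v, g)
                     = hecke_R G \<Gamma> g * card (right_cosets_of V V0 S)
                 \<and> hecke_L (semidirect V G \<alpha>) (V0 \<times> \<Gamma>) (v, g)
                     = hecke_L G \<Gamma> g * card (left_cosets_of V S (\<alpha> g ` V0)))
               \<and> hecke_modular (semidirect V G \<alpha>) (V0 \<times> \<Gamma>) (v, g)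
                   = hecke_modular V V0 v * hecke_modular G \<Gamma> g *
                     (real (sub_index V V0 (V0 \<inter> \<alpha> g ` V0)) /
                      real (sub_index V V0 (V0 \<inter> \<alpha> (inv\<^bsub>G\<^esub> g) ` V0)))))"
proof -
  interpret invariant_subgroups V G \<alpha> V0 \<Gamma>
    using assms
    by (simp add: invariant_subgroups_def invariant_subgroups_axioms_def
        automorphism_action_def automorphism_action_axioms_def)
  have iff: "hecke_pair (semidirect V G \<alpha>) (V0 \<times> \<Gamma>) \<longleftrightarrow>
      (hecke_pair V V0 \<and> finite_orbits_on_double_cosets V V0 G \<Gamma> \<alpha>) \<and>
      (hecke_pair G \<Gamma> \<and> (\<forall>g\<in>carrier G. commensurable V V0 (\<alpha> g ` V0)))"
    using hecke_pair_semidirect_imp hecke_pair_semidirectI by blast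
  show ?thesis
    unfolding iff[symmetric] Let_def coset_stabilizer_def[symmetric] orbit_double_coset_def[symmetric]
    using hecke_extension_embedding hecke_R_semidirect hecke_L_semidirect hecke_modular_semidirect
    by blast
qed

end
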